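(* For any class $A\in\{\widehat{\mathsf{LDL}},\mathsf{LDL}\}$ and $B\in\{\mathsf{PL}_1,\mathsf{PL}_\infty\}$, the classes $A$ and $B$ are incomparable, i.e. $A\not\subseteq B$ and $B\not\subseteq A$. In other words, every one of the classes $\mathsf{PL}_1,\widehat{\mathsf{PT}}_1,\mathsf{PT}_1,\mathsf{PL}_\infty$ is incomparable to each of the classes $\widehat{\mathsf{LDL}}$ and $\mathsf{LDL}$.
   Context: Classes consist of families $(f_k)_{k\ge1}$ with $f_k:\{0,1\}^{N_k}\to\{0,1\}$, $N_k$ strictly increasing; "polynomial" means bounded by a fixed polynomial in $N_k$ (write $N$ for the number of variables). Define $\mathrm{sign}(x)=1$ if $x>0$ and $\mathrm{sign}(x)=0$ if $x\le0$. A linear threshold function (LTF) on $\{0,1\}^N$ is a function $x\mapsto\mathrm{sign}(w_0+\sum_i w_ix_i)$ with real weights $w_0,\dots,w_N$. A linear decision list of size $k$ is a sequence $(L_1,a_1),\dots,(L_k,a_k)$ with $a_i\in\{0,1\}$, each $L_i$ an LTF, $L_k\equiv1$; it computes $f(x)=a_i$, where $i$ is the least index with $L_i(x)=1$. $\mathsf{LDL}$: families computable by polynomial-size linear decision lists. $\widehat{\mathsf{LDL}}$: families computable by polynomial-size linear decision lists in which, furthermore, the weights of all LTF queries are integers of polynomially bounded absolute value. For $S\subseteq[N]$ let $\chi_S(x)=(-1)^{\sum_{i\in S}x_i}$, and for $f:\{0,1\}^N\to\mathbb{R}$ let $\widehat f(S)=2^{-N}\sum_{x\in\{0,1\}^N}f(x)\chi_S(x)$.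 In the next two definitions these coefficients are taken for the $\{0,1\}$-valued function $f$ itself. $\mathsf{PL}_1$: families of functions $f:\{0,1\}^N\to\{0,1\}$ with $\sum_{S\subseteq[N]}|\widehat f(S)|\le\mathrm{poly}(N)$. $\mathsf{PL}_\infty$: families of functions $f:\{0,1\}^N\to\{0,1\}$ with $\max_{S\subseteq[N]}|\widehat f(S)|\ge 1/\mathrm{poly}(N)$. $\mathsf{PT}_1$: families computable by polynomial-size $\mathsf{LTF}\circ\mathsf{PARITY}$ circuits, i.e. an LTF (arbitrary real weights) applied to the outputs of polynomially many parities of subsets of the variables. $\widehat{\mathsf{PT}}_1$: families computable by polynomial-size $\mathsf{MAJ}\circ\mathsf{PARITY}$ circuits, i.e. a majority gate $\mathsf{MAJ}_m(z)=\mathrm{sign}(z_1+\dots+z_m-m/2)$ with $m$ polynomially bounded, whose inputs are constants, or parities of subsets of the variables or their negations, repetitions allowed. *)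

theory Defs
  imports Complex_Main "HOL-Library.FuncSet" "HOL-Computational_Algebra.Polynomial"
begin

text \<open>
  The bits 0 and 1 are natural numbers, and a point of the cube of dimension \<open>n\<close> is a function on
  the coordinates \<open>1, \<dots>, n\<close>.
\<close>

definition bool_cube :: "nat \<Rightarrow> (nat \<Rightarrow> nat) set" where
  "bool_cube n = {1..n} \<rightarrow>\<^sub>E {0, 1}"

text \<open>
  A family is a pair \<open>(N, f)\<close>, where \<open>f k\<close> is a Boolean function of \<open>N k\<close> variables. Only the
  indices \<open>k \<ge> 1\<close> and the values of \<open>f k\<close> on the cube of dimension \<open>N k\<close> carry meaning; all classes
  below depend on these data only.
\<close>

type_synonym bool_family = "(nat \<Rightarrow> nat) \<times> (nat \<Rightarrow> (nat \<Rightarrow> nat) \<Rightarrow> nat)"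

definition bool_families :: "bool_family set" where
  "bool_families =
     {(N, f). strict_mono_on {1..} N \<and> (\<forall>k\<ge>1. f k \<in> bool_cube (N k) \<rightarrow> {0, 1})}"

definition threshold_sign :: "real \<Rightarrow> nat" where
  "threshold_sign t = (if t > 0 then 1 else 0)"

definition ltf :: "nat \<Rightarrow> (nat \<Rightarrow> real) \<Rightarrow> (nat \<Rightarrow> nat) \<Rightarrow> nat" where
  "ltf n w x = threshold_sign (w 0 + (\<Sum>i=1..n. w i * real (x i)))"

text \<open>
  The list \<open>(L\<^sub>1, a\<^sub>1), \<dots>, (L\<^sub>s, a\<^sub>s)\<close> is given by the weight vectors \<open>W i\<close> of the queries \<open>L\<^sub>i\<close> and the
  outputs \<open>a i\<close>. The size \<open>s\<close> is positive because the last query is required to exist.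
\<close>

definition computes_ldl ::
  "nat \<Rightarrow> nat \<Rightarrow> (nat \<Rightarrow> nat \<Rightarrow> real) \<Rightarrow> (nat \<Rightarrow> nat) \<Rightarrow> ((nat \<Rightarrow> nat) \<Rightarrow> nat) \<Rightarrow> bool" where
  "computes_ldl n s W a f \<longleftrightarrow>
     s \<ge> 1 \<and> (\<forall>i\<in>{1..s}. a i \<in> {0, 1}) \<and>
     (\<forall>x\<in>bool_cube n. ltf n (W s) x = 1) \<and>
     (\<forall>x\<in>bool_cube n. f x = a (LEAST i. i \<in> {1..s} \<and> ltf n (W i) x = 1))"

definition LDL :: "bool_family set" where
  "LDL = {(N, f) \<in> bool_families.
     \<exists>p :: real poly. \<forall>k\<ge>1. \<exists>s W a.
       real s \<le> poly p (real (N k)) \<and> computes_ldl (N k) s W a (f k)}"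

definition LDL_hat :: "bool_family set" where
  "LDL_hat = {(N, f) \<in> bool_families.
     \<exists>(p :: real poly) (q :: real poly). \<forall>k\<ge>1. \<exists>s W a.
       real s \<le> poly p (real (N k)) \<and> computes_ldl (N k) s W a (f k) \<and>
       (\<forall>i\<in>{1..s}. \<forall>j\<in>{0..N k}. W i j \<in> \<int> \<and> \<bar>W i j\<bar> \<le> poly q (real (N k)))}"

definition character :: "nat set \<Rightarrow> (nat \<Rightarrow> nat) \<Rightarrow> real" where
  "character S x = (- 1) ^ (\<Sum>i\<in>S. x i)"

definition fourier_coeff :: "nat \<Rightarrow> ((nat \<Rightarrow> nat) \<Rightarrow> real) \<Rightarrow> nat set \<Rightarrow> real" where
  "fourier_coeff n f S = (\<Sum>x\<in>bool_cube n. f x * character S x) / 2 ^ n"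

definition PL_1 :: "bool_family set" where
  "PL_1 = {(N, f) \<in> bool_families.
     \<exists>p :: real poly. \<forall>k\<ge>1.
       (\<Sum>S\<in>Pow {1..N k}. \<bar>fourier_coeff (N k) (\<lambda>x. real (f k x)) S\<bar>) \<le> poly p (real (N k))}"

text \<open>
  Positivity of the polynomial at \<open>N k\<close> is required explicitly, because division by zero yields zero
  and a negative denominator would make the lower bound vacuous.
\<close>

definition PL_inf :: "bool_family set" where
  "PL_inf = {(N, f) \<in> bool_families.
     \<exists>p :: real poly. \<forall>k\<ge>1. poly p (real (N k)) > 0 \<and>
       Max ((\<lambda>S. \<bar>fourier_coeff (N k) (\<lambda>x. real (f k x)) S\<bar>) ` Pow {1..N k})
         \<ge> 1 / poly p (real (N k))}"

definition parity_of :: "nat set \<Rightarrow> (nat \<Rightarrow> nat) \<Rightarrow> nat" where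
  "parity_of S x = (\<Sum>i\<in>S. x i) mod 2"

definition PT_1 :: "bool_family set" where
  "PT_1 = {(N, f) \<in> bool_families.
     \<exists>p :: real poly. \<forall>k\<ge>1. \<exists>m w S.
       real m \<le> poly p (real (N k)) \<and> (\<forall>j\<in>{1..m}. S j \<subseteq> {1..N k}) \<and>
       (\<forall>x\<in>bool_cube (N k). f k x = ltf m w (\<lambda>j. parity_of (S j) x))}"

definition maj :: "nat \<Rightarrow> (nat \<Rightarrow> nat) \<Rightarrow> nat" where
  "maj m z = threshold_sign ((\<Sum>j=1..m. real (z j)) - real m / 2)"

definition maj_inputs :: "nat \<Rightarrow> ((nat \<Rightarrow> nat) \<Rightarrow> nat) set" where
  "maj_inputs n = {\<lambda>x. 0, \<lambda>x. 1} \<union> {parity_of S | S. S \<subseteq> {1..n}}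
     \<union> {\<lambda>x. 1 - parity_of S x | S. S \<subseteq> {1..n}}"

definition PT_1_hat :: "bool_family set" where
  "PT_1_hat = {(N, f) \<in> bool_families.
     \<exists>p :: real poly. \<forall>k\<ge>1. \<exists>m g.
       real m \<le> poly p (real (N k)) \<and> (\<forall>j\<in>{1..m}. g j \<in> maj_inputs (N k)) \<and>
       (\<forall>x\<in>bool_cube (N k). f k x = maj m (\<lambda>j. g j x))}"

definition incomparable :: "'a set \<Rightarrow> 'a set \<Rightarrow> bool" where
  "incomparable A B \<longleftrightarrow> \<not> A \<subseteq> B \<and> \<not> B \<subseteq> A"

end

theory Submission
  imports Defs
begin

text \<open>
  Three families separate all the classes, once \<open>PL_1 \<subseteq> PT_1_hat \<subseteq> PT_1\<close> is known (the first
  inclusion by sampling characters).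

  The complete quadratic function depends on the Hamming weight only, so it has a short decision list
  with small weights; its correlation with every parity is exponentially small, which a threshold of
  few parities does not allow. Because \<open>PL_inf\<close> is defined through \<open>{0, 1}\<close>-valued functions, the zero
  family already lies outside it.

  In the other direction, let the orientation of each edge of a tournament be the parity of two
  variables, one for the row player and one for the column player, and ask whether the tournament has
  no sink. Sinks are unique, so this is \<open>1\<close> minus a sum of subcube indicators and has small spectral
  norm. A decision list of \<open>s\<close> threshold queries leaves a monochromatic rectangle of density \<open>1 / s\<close> in
  both coordinates. Shearer's lemma for the stars of the vertices excludes large rectangles without
  sinks, and large rectangles with sinks are excluded because sinks are rare.
\<close>

section \<open>Growth of polynomials against powers of two\<close>

text \<open>Turns exponential lower bounds on sizes into contradictions with polynomial upper
  bounds; \<open>k\<close> leaves room for side conditions on the index. With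
  \<open>x = ln 2 * n\<close>, each monomial reduces to the limit of
  \<open>x ^ i / exp x\<close>.\<close>

lemma poly_less_two_power: 
  fixes q :: "real poly" shows "\<exists>n\<ge>k. poly q (real n) < 2 ^ n"
proof -
  have i: "(\<lambda>n. real n ^ i / 2 ^ n) \<longlonglongrightarrow> 0" for i
  proof -
    have "((\<lambda>x. x ^ i / exp x) \<longlongrightarrow> (0::real)) at_top" by (rule tendsto_power_div_exp_0)
    moreover have "filterlim (\<lambda>n. ln 2 * real n) at_top sequentially"
      by (rule filterlim_tendsto_pos_mult_at_top[OF tendsto_const _ filterlim_real_sequentially]) simp
    ultimately have "(\<lambda>n. (ln 2 * real n) ^ i / exp (ln 2 * real n)) \<longlonglongrightarrow> 0"
      by (rule filterlim_compose)
    hence "(\<lambda>n. (1 / ln 2) ^ i * ((ln 2 * real n) ^ i / exp (ln 2 * real n))) \<longlonglongrightarrow> (1 / ln 2) ^ i * 0"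
      by (rule tendsto_mult_left)
    moreover have "exp (ln 2 * real n) = 2 ^ n" for n
      by (simp add: exp_of_nat2_mult)
    moreover have "(1 / ln 2) ^ i * ((ln 2 * real n) ^ i / 2 ^ n) = real n ^ i / 2 ^ n" for n
      by (simp add: power_mult_distrib power_one_over)
    ultimately show ?thesis by simp
  qed
  have "(\<lambda>n. \<Sum>i\<le>degree q. coeff q i * (real n ^ i / 2 ^ n)) \<longlonglongrightarrow> (\<Sum>i\<le>degree q. coeff q i * 0)"
    by (intro tendsto_sum tendsto_mult_left i)
  hence "(\<lambda>n. poly q (real n) / 2 ^ n) \<longlonglongrightarrow> 0"
    by (simp add: poly_altdef sum_divide_distrib)
  hence "\<forall>\<^sub>F n in sequentially. poly q (real n) / 2 ^ n < 1"
    by (rule order_tendstoD) simp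
  then obtain n0 where "\<forall>n\<ge>n0. poly q (real n) / 2 ^ n < 1"
    by (auto simp: eventually_sequentially)
  hence "poly q (real (max k n0)) / 2 ^ max k n0 < 1" by simp
  thus ?thesis by (intro exI[of _ "max k n0"]) (simp add: divide_simps)
qed

subsection \<open>Fourier analysis on the cube\<close>

lemma finite_bool_cube [simp]: "finite (bool_cube n)"
  unfolding bool_cube_def by (intro finite_PiE) auto

lemma bool_cube_bit: "x \<in> bool_cube n \<Longrightarrow> i \<in> {1..n} \<Longrightarrow> x i \<in> {0, 1}"
  unfolding bool_cube_def by blast

lemma card_bool_cube: "card (bool_cube n) = 2 ^ n"
  unfolding bool_cube_def by (simp add: card_PiE numeral_2_eq_2)

lemma character_prod: "character S x = (\<Prod>i\<in>S. (- 1) ^ x i)"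
  unfolding character_def by (simp add: power_sum)

lemma abs_character [simp]: "\<bar>character S x\<bar> = 1"
  unfolding character_def by (simp add: power_abs)

lemma character_empty [simp]: "character {} x = 1"
  unfolding character_def by simp

lemma character_self_mult [simp]: "character S x * character S x = 1"
  unfolding character_def by (simp flip: power_mult_distrib)

text \<open>The common part \<open>S \<inter> T\<close> enters both factors, and its square is
  1.\<close>

lemma character_mult:
  assumes "finite S" "finite T"
  shows "character S x * character T x = character (sym_diff S T) x"
proof -
  have "character S x = character (S - T) x * character (S \<inter> T) x"
    unfolding character_prod by (subst prod.Int_Diff[OF assms(1), of _ T]) (simp add: mult.commute)
  moreover have "character T x = character (T - S) x * character (S \<inter> T) x"
    unfolding character_prod
    by (subst prod.Int_Diff[OF assms(2), of _ S]) (simp add: mult.commute Int_commute)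
  moreover have "character (sym_diff S T) x = character (S - T) x * character (T - S) x"
    unfolding character_prod using assms by (intro prod.union_disjoint) auto
  ultimately show ?thesis
    using character_self_mult[of "S \<inter> T" x] by (simp add: mult_ac)
qed

lemma character_parity: "character S x = 1 - 2 * real (parity_of S x)"
  unfolding character_def parity_of_def
  by (cases "even (\<Sum>i\<in>S. x i)") (simp_all add: even_iff_mod_2_eq_zero odd_iff_mod_2_eq_one)

text \<open>Distributivity separates the coordinates. The codomain is general because real
  characters and complex powers of \<open>\<i>\<close> are both summed in this way.\<close>

lemma sum_bool_cube_prod:
  fixes g :: "nat \<Rightarrow> nat \<Rightarrow> 'a::comm_semiring_1"
  shows "(\<Sum>x\<in>bool_cube n. \<Prod>i=1..n. g i (x i)) = (\<Prod>i=1..n. g i 0 + g i 1)"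
  unfolding bool_cube_def by (subst prod_sum_PiE [symmetric]) auto

lemma character_extend:
  assumes "S \<subseteq> {1..n}"
  shows "character S x = (\<Prod>i=1..n. if i \<in> S then (- 1) ^ x i else 1)"
  unfolding character_prod using assms
  by (simp add: prod.If_cases Int_absorb1)

lemma sum_character:
  assumes "S \<subseteq> {1..n}"
  shows "(\<Sum>x\<in>bool_cube n. character S x) = (if S = {} then 2 ^ n else 0)"
proof -
  have "(\<Sum>x\<in>bool_cube n. character S x) = (\<Prod>i=1..n. if i \<in> S then 0 else 2)"
    unfolding character_extend[OF assms] sum_bool_cube_prod[of "\<lambda>i b. if i \<in> S then (- 1) ^ b else 1"]
    by (rule prod.cong) simp_all
  also have "\<dots> = (if S = {} then 2 ^ n else 0)"
  proof (cases "S = {}")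
    case False
    then obtain i where "i \<in> S" by blast
    moreover from this have "i \<in> {1..n}" using assms by blast
    ultimately show ?thesis by (auto intro!: prod_zero)
  qed simp
  finally show ?thesis .
qed


text \<open>The orthogonality dual to \<open>sum_character\<close>: \<open>prod_add\<close> turns
  the sum over sets into a product over coordinates, with a factor 0 wherever \<open>x\<close> and
  \<open>y\<close> differ.\<close>

lemma sum_Pow_character:
  assumes "x \<in> bool_cube n" "y \<in> bool_cube n"
  shows "(\<Sum>S\<in>Pow {1..n}. character S x * character S y) = (if x = y then 2 ^ n else 0)"
proof -
  have "(\<Sum>S\<in>Pow {1..n}. character S x * character S y) =
      (\<Sum>S\<in>Pow {1..n}. (\<Prod>i\<in>S. (- 1) ^ x i * (- 1) ^ y i) * (\<Prod>i\<in>{1..n} - S. 1))"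
    by (simp add: character_prod prod.distrib)
  also have "\<dots> = (\<Prod>i=1..n. (- 1) ^ x i * (- 1) ^ y i + (1 :: real))"
    by (rule prod_add [symmetric]) simp
  also have "\<dots> = (\<Prod>i=1..n. if x i = y i then 2 else 0)"
    using bool_cube_bit[OF assms(1)] bool_cube_bit[OF assms(2)]
    by (intro prod.cong refl) fastforce
  also have "\<dots> = (if x = y then 2 ^ n else 0)"
  proof (cases "x = y")
    case False
    then obtain i where "i \<in> {1..n}" "x i \<noteq> y i"
      using assms PiE_ext unfolding bool_cube_def by metis
    with False show ?thesis by (auto intro!: prod_zero)
  qed simp
  finally show ?thesis .
qed

lemma fourier_inversion:
  assumes "x \<in> bool_cube n"
  shows "f x = (\<Sum>S\<in>Pow {1..n}. fourier_coeff n f S * character S x)"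
proof -
  have "(\<Sum>S\<in>Pow {1..n}. fourier_coeff n f S * character S x) =
      (\<Sum>S\<in>Pow {1..n}. \<Sum>y\<in>bool_cube n. f y * (character S y * character S x)) / 2 ^ n"
    by (simp add: fourier_coeff_def sum_divide_distrib sum_distrib_right mult.assoc)
  also have "\<dots> = (\<Sum>y\<in>bool_cube n. f y * (\<Sum>S\<in>Pow {1..n}. character S y * character S x)) / 2 ^ n"
    by (subst sum.swap) (simp add: sum_distrib_left)
  also have "\<dots> = (\<Sum>y\<in>bool_cube n. if y = x then f y * 2 ^ n else 0) / 2 ^ n"
    using assms
    by (intro arg_cong2[of _ _ _ _ "(/)"] sum.cong refl) (simp only: sum_Pow_character, simp)
  also have "\<dots> = f x" using assms by simp
  finally show ?thesis by simp
qed

lemma fourier_coeff_add: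
  "fourier_coeff n (\<lambda>x. f x + g x) S = fourier_coeff n f S + fourier_coeff n g S"
  by (simp add: fourier_coeff_def distrib_right sum.distrib add_divide_distrib)

lemma fourier_coeff_cmult:
  "fourier_coeff n (\<lambda>x. c * f x) S = c * fourier_coeff n f S"
  by (simp add: fourier_coeff_def sum_distrib_left mult_ac)

lemma fourier_coeff_sum:
  "fourier_coeff n (\<lambda>x. \<Sum>i\<in>I. f i x) S = (\<Sum>i\<in>I. fourier_coeff n (f i) S)"
  by (simp add: fourier_coeff_def sum_distrib_right sum_divide_distrib) (subst sum.swap, simp)

lemma fourier_coeff_character_mult:
  assumes "S \<subseteq> {1..n}" "D \<subseteq> {1..n}"
  shows "fourier_coeff n (\<lambda>x. character D x * f x) S = fourier_coeff n f (sym_diff D S)"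
proof -
  have "finite S" "finite D" using assms finite_subset by blast+
  thus ?thesis
    by (simp add: fourier_coeff_def character_mult [symmetric] mult_ac)
qed

lemma fourier_coeff_character:
  assumes "S \<subseteq> {1..n}" "D \<subseteq> {1..n}"
  shows "fourier_coeff n (character D) S = (if S = D then 1 else 0)"
proof -
  have "finite S" "finite D" using assms finite_subset by blast+
  hence "fourier_coeff n (character D) S = (\<Sum>x\<in>bool_cube n. character (sym_diff D S) x) / 2 ^ n"
    by (simp add: fourier_coeff_def character_mult)
  also have "\<dots> = (if S = D then 1 else 0)"
    using assms by (subst sum_character) auto
  finally show ?thesis .
qed

section \<open>The spectral norm\<close>

definition spectral_norm :: "nat \<Rightarrow> ((nat \<Rightarrow> nat) \<Rightarrow> real) \<Rightarrow> real" where
  "spectral_norm n f = (\<Sum>S\<in>Pow {1..n}. \<bar>fourier_coeff n f S\<bar>)"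

lemma spectral_norm_add: "spectral_norm n (\<lambda>x. f x + g x) \<le> spectral_norm n f + spectral_norm n g"
  by (simp add: spectral_norm_def fourier_coeff_add sum.distrib [symmetric] sum_mono)

lemma spectral_norm_cmult: "spectral_norm n (\<lambda>x. c * f x) = \<bar>c\<bar> * spectral_norm n f"
  by (simp add: spectral_norm_def fourier_coeff_cmult abs_mult sum_distrib_left)

lemma spectral_norm_sum: "spectral_norm n (\<lambda>x. \<Sum>i\<in>I. f i x) \<le> (\<Sum>i\<in>I. spectral_norm n (f i))"
  unfolding spectral_norm_def fourier_coeff_sum
  by (subst sum.swap) (intro sum_mono sum_abs)

lemma spectral_norm_one: "spectral_norm n (\<lambda>x. 1) = 1"
proof -
  have "spectral_norm n (character {}) = (\<Sum>S\<in>Pow {1..n}. if S = {} then 1 else 0)"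
    unfolding spectral_norm_def by (intro sum.cong refl) (auto simp: fourier_coeff_character)
  moreover have "character {} = (\<lambda>x. 1)" by (rule ext) simp
  ultimately show ?thesis by simp
qed

text \<open>Multiplication by \<open>character D\<close> permutes the coefficients by the involution
  \<open>sym_diff D\<close> of the index sets.\<close>

lemma spectral_norm_character_mult:
  assumes "D \<subseteq> {1..n}"
  shows "spectral_norm n (\<lambda>x. character D x * f x) = spectral_norm n f"
proof -
  have "bij_betw (sym_diff D) (Pow {1..n}) (Pow {1..n})"
    by (rule bij_betw_byWitness[where f' = "sym_diff D"]) (use assms in auto)
  from sum.reindex_bij_betw[OF this, of "\<lambda>S. \<bar>fourier_coeff n f S\<bar>"] show ?thesis
    using assms by (simp add: spectral_norm_def fourier_coeff_character_mult)
qed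

text \<open>Each factor \<open>(1 \<plusminus> \<chi>\<^sub>D) / 2\<close> is the average of two maps preserving the spectral norm.\<close>

lemma spectral_norm_prod_half:
  assumes "finite J" "\<And>j. j \<in> J \<Longrightarrow> D j \<subseteq> {1..n}" "\<And>j. j \<in> J \<Longrightarrow> \<bar>c j\<bar> = 1"
  shows "spectral_norm n (\<lambda>x. \<Prod>j\<in>J. (1 + c j * character (D j) x) / 2) \<le> 1"
  using assms
proof (induction J rule: finite_induct)
  case empty
  show ?case by (simp add: spectral_norm_one)
next
  case (insert j J)
  let ?g = "\<lambda>x. \<Prod>j\<in>J. (1 + c j * character (D j) x) / 2"
  have "spectral_norm n (\<lambda>x. (\<Prod>j\<in>insert j J. (1 + c j * character (D j) x) / 2)) =
      spectral_norm n (\<lambda>x. 1 / 2 * ?g x + c j / 2 * (character (D j) x * ?g x))"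
    using insert.hyps by (simp add: field_simps)
  also have "\<dots> \<le> spectral_norm n (\<lambda>x. 1 / 2 * ?g x) +
      spectral_norm n (\<lambda>x. c j / 2 * (character (D j) x * ?g x))"
    by (rule spectral_norm_add)
  also have "\<dots> = spectral_norm n ?g"
    unfolding spectral_norm_cmult
    using insert.prems by (simp add: spectral_norm_character_mult)
  also have "\<dots> \<le> 1" using insert by simp
  finally show ?case .
qed

subsection \<open>Thresholds of parities\<close>

text \<open>A common form for all gate inputs; the constants take weight 0 on the parity of the
  empty set.\<close>

lemma maj_input_affine:
  assumes "g \<in> maj_inputs n"
  obtains c w S where "S \<subseteq> {1..n}" "\<And>x. real (g x) = c + w * real (parity_of S x)"
proof -
  consider (zero) "g = (\<lambda>x. 0)" | (one) "g = (\<lambda>x. 1)"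
    | (pos) S where "S \<subseteq> {1..n}" "g = parity_of S"
    | (neg) S where "S \<subseteq> {1..n}" "g = (\<lambda>x. 1 - parity_of S x)"
    using assms unfolding maj_inputs_def by blast
  thus ?thesis
  proof cases
    case zero thus ?thesis by (intro that[of "{}" 0 0]) auto
  next
    case one thus ?thesis by (intro that[of "{}" 1 0]) auto
  next
    case (pos S) thus ?thesis by (intro that[of S 0 1]) auto
  next
    case (neg S)
    have "parity_of S x \<le> 1" for x unfolding parity_of_def by linarith
    with neg show ?thesis by (intro that[of S 1 "- 1"]) (auto simp: of_nat_diff)
  qed
qed

lemma PT_1_hat_subset_PT_1: "PT_1_hat \<subseteq> PT_1"
proof
  fix F assume "F \<in> PT_1_hat"
  then obtain N f p where F: "F = (N, f)" "(N, f) \<in> bool_families"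
    and p: "\<And>k. k \<ge> 1 \<Longrightarrow> \<exists>m g. real m \<le> poly p (real (N k)) \<and> (\<forall>j\<in>{1..m}. g j \<in> maj_inputs (N k)) \<and>
       (\<forall>x\<in>bool_cube (N k). f k x = maj m (\<lambda>j. g j x))"
    unfolding PT_1_hat_def by auto
  have "\<exists>m w S. real m \<le> poly p (real (N k)) \<and> (\<forall>j\<in>{1..m}. S j \<subseteq> {1..N k}) \<and>
       (\<forall>x\<in>bool_cube (N k). f k x = ltf m w (\<lambda>j. parity_of (S j) x))" if k: "k \<ge> 1" for k
  proof -
    obtain m g where mg: "real m \<le> poly p (real (N k))" "\<forall>j\<in>{1..m}. g j \<in> maj_inputs (N k)"
      "\<forall>x\<in>bool_cube (N k). f k x = maj m (\<lambda>j. g j x)" using p[OF k] by blast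
    have "\<forall>j\<in>{1..m}. \<exists>c w S. S \<subseteq> {1..N k} \<and> (\<forall>x. real (g j x) = c + w * real (parity_of S x))"
      using mg(2) maj_input_affine by metis
    then obtain c w S where cwS: "\<And>j. j \<in> {1..m} \<Longrightarrow> S j \<subseteq> {1..N k}"
      "\<And>j x. j \<in> {1..m} \<Longrightarrow> real (g j x) = c j + w j * real (parity_of (S j) x)"
      unfolding bchoice_iff by metis
    \<comment> \<open>Gate inputs start at 1, so index 0 is free for the threshold: it collects the
      constants of all inputs and the \<open>m / 2\<close> of the majority.\<close>
    define w' where "w' = w(0 := (\<Sum>j=1..m. c j) - real m / 2)"
    have "maj m (\<lambda>j. g j x) = ltf m w' (\<lambda>j. parity_of (S j) x)" for x
    proof -
      have "(\<Sum>j=1..m. real (g j x)) = (\<Sum>j=1..m. c j) + (\<Sum>j=1..m. w j * real (parity_of (S j) x))"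
        by (subst sum.distrib [symmetric]) (intro sum.cong refl cwS(2))
      also have "(\<Sum>j=1..m. w j * real (parity_of (S j) x)) = (\<Sum>j=1..m. w' j * real (parity_of (S j) x))"
        by (intro sum.cong refl) (auto simp: w'_def)
      finally show ?thesis by (simp add: maj_def ltf_def w'_def algebra_simps)
    qed
    with mg cwS(1) show ?thesis by (intro exI[of _ m] exI[of _ w'] exI[of _ S]) auto
  qed
  with F show "F \<in> PT_1" unfolding PT_1_def by auto
qed

text \<open>
  If \<open>F\<close> is the sum inside the threshold gate and \<open>s = 2 f - 1\<close>, then \<open>\<Sum> \<bar>F\<bar> = \<Sum> F s\<close>. Every
  Fourier coefficient of \<open>F\<close> is at most the mean of \<open>\<bar>F\<bar>\<close>, and only those at the \<open>m\<close> sets and at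
  the empty set can be nonzero.
\<close>

lemma threshold_of_parities_correlation:
  fixes f :: "(nat \<Rightarrow> nat) \<Rightarrow> nat"
  assumes S: "\<And>j. j \<in> {1..m} \<Longrightarrow> S j \<subseteq> {1..n}"
    and f: "\<And>x. x \<in> bool_cube n \<Longrightarrow> f x = ltf m w (\<lambda>j. parity_of (S j) x)"
    and nz: "y \<in> bool_cube n" "f y = 1"
    and B: "\<And>D. D \<subseteq> {1..n} \<Longrightarrow> \<bar>\<Sum>x\<in>bool_cube n. (2 * real (f x) - 1) * character D x\<bar> \<le> B"
  shows "2 ^ n \<le> (real m + 1) * B"
proof -
  define F where "F x = w 0 + (\<Sum>j=1..m. w j * real (parity_of (S j) x))" for x
  define s where "s x = 2 * real (f x) - 1" for x
  define T where "T = insert {} (S ` {1..m})"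
  define M where "M = (\<Sum>x\<in>bool_cube n. \<bar>F x\<bar>)"
  have T: "finite T" "T \<subseteq> Pow {1..n}" unfolding T_def using S by (simp, blast)
  have "card T \<le> Suc (card (S ` {1..m}))" unfolding T_def by (rule card_insert_le_m1) auto
  also have "\<dots> \<le> Suc m" using card_image_le[of "{1..m}" S] by simp
  finally have cardT: "card T \<le> Suc m" .
  have s: "F x * s x = \<bar>F x\<bar>" if "x \<in> bool_cube n" for x
    using f[OF that] by (auto simp: s_def F_def ltf_def threshold_sign_def)
  have "threshold_sign (F y) = 1" using f[OF nz(1)] unfolding nz(2) F_def ltf_def by simp
  hence "F y > 0" by (simp add: threshold_sign_def split: if_splits)
  \<comment> \<open>The accepted point \<open>y\<close> keeps \<open>F\<close> from vanishing on the
    whole cube, so \<open>M\<close> can be cancelled at the end.\<close>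
  hence "M > 0" unfolding M_def using nz(1) by (intro sum_pos2[of _ y]) auto
  have Mcoeff: "\<bar>fourier_coeff n F D\<bar> \<le> M / 2 ^ n" for D
  proof -
    have "\<bar>\<Sum>x\<in>bool_cube n. F x * character D x\<bar> \<le> (\<Sum>x\<in>bool_cube n. \<bar>F x * character D x\<bar>)"
      by (rule sum_abs)
    thus ?thesis by (simp add: fourier_coeff_def M_def abs_mult divide_right_mono)
  qed
  have zero: "fourier_coeff n F D = 0" if D: "D \<subseteq> {1..n}" "D \<notin> T" for D
  proof -
    \<comment> \<open>Each parity is an affine function of its character, so the spectrum of
      \<open>F\<close> lies in \<open>T\<close>; the constants fall on the empty set.\<close>
    have "F = (\<lambda>x. (w 0 + (\<Sum>j=1..m. w j / 2)) * character {} x + (\<Sum>j=1..m. (- w j / 2) * character (S j) x))"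
    proof
      fix x
      have "w j * real (parity_of (S j) x) = w j / 2 + (- w j / 2) * character (S j) x" for j
        by (simp add: character_parity field_simps)
      thus "F x = (w 0 + (\<Sum>j=1..m. w j / 2)) * character {} x + (\<Sum>j=1..m. (- w j / 2) * character (S j) x)"
        by (simp only: F_def sum.distrib character_empty) simp
    qed
    moreover have "fourier_coeff n (character {}) D = 0" 
      using D by (subst fourier_coeff_character) (auto simp: T_def)
    moreover have "fourier_coeff n (character (S j)) D = 0" if "j \<in> {1..m}" for j
      using D that S by (subst fourier_coeff_character) (auto simp: T_def)
    ultimately show ?thesis
      by (simp only: fourier_coeff_add fourier_coeff_cmult fourier_coeff_sum) simp
  qed
  have "M = (\<Sum>x\<in>bool_cube n. F x * s x)"
    unfolding M_def by (intro sum.cong refl) (simp add: s)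
  also have "\<dots> = (\<Sum>x\<in>bool_cube n. (\<Sum>D\<in>T. fourier_coeff n F D * character D x) * s x)"
  proof (intro sum.cong refl arg_cong2[of _ _ _ _ "(*)"])
    fix x assume "x \<in> bool_cube n"
    hence "F x = (\<Sum>D\<in>Pow {1..n}. fourier_coeff n F D * character D x)" by (rule fourier_inversion)
    also have "\<dots> = (\<Sum>D\<in>T. fourier_coeff n F D * character D x)"
      using T zero by (intro sum.mono_neutral_right) auto
    finally show "F x = (\<Sum>D\<in>T. fourier_coeff n F D * character D x)" .
  qed
  also have "\<dots> = (\<Sum>D\<in>T. fourier_coeff n F D * (\<Sum>x\<in>bool_cube n. s x * character D x))"
    by (simp add: sum_distrib_left sum_distrib_right mult_ac) (rule sum.swap)
  also have "\<dots> \<le> (\<Sum>D\<in>T. M / 2 ^ n * B)"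
  proof (rule sum_mono)
    fix D assume "D \<in> T"
    with T have D: "D \<subseteq> {1..n}" by auto
    have "fourier_coeff n F D * (\<Sum>x\<in>bool_cube n. s x * character D x)
      \<le> \<bar>fourier_coeff n F D\<bar> * \<bar>\<Sum>x\<in>bool_cube n. s x * character D x\<bar>"
      by (simp flip: abs_mult)
    also have "\<dots> \<le> M / 2 ^ n * B"
      using \<open>M > 0\<close> Mcoeff[of D] B[OF D] by (intro mult_mono) (auto simp: s_def)
    finally show "fourier_coeff n F D * (\<Sum>x\<in>bool_cube n. s x * character D x) \<le> M / 2 ^ n * B" .
  qed
  also have "\<dots> = real (card T) * B * (M / 2 ^ n)" by simp
  finally have "2 ^ n \<le> real (card T) * B" using \<open>M > 0\<close> by (simp add: field_simps)
  moreover have "B \<ge> 0" using B[of "{}"] abs_ge_zero order_trans by blast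
  ultimately show ?thesis
    using cardT mult_right_mono[of "real (card T)" "real m + 1" B] by simp
qed

subsection \<open>Sampling characters\<close>

lemma weighted_average_attained:
  fixes p \<phi> :: "'a \<Rightarrow> real"
  assumes "finite T" "\<And>t. t \<in> T \<Longrightarrow> p t \<ge> 0" "(\<Sum>t\<in>T. p t) = 1" "(\<Sum>t\<in>T. p t * \<phi> t) \<le> c"
  obtains t where "t \<in> T" "\<phi> t \<le> c"
proof (rule ccontr)
  assume "\<not> thesis"
  with that have less: "c < \<phi> t" if "t \<in> T" for t using \<open>t \<in> T\<close> by fastforce
  have "\<exists>t\<in>T. p t > 0"
    using assms(2,3) sum_nonpos[of T p] by (metis not_less not_one_le_zero)
  then obtain t where t: "t \<in> T" "p t > 0" by blast
  have "(\<Sum>t\<in>T. p t * c) < (\<Sum>t\<in>T. p t * \<phi> t)"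
  proof (rule sum_strict_mono_ex1)
    show "\<forall>t\<in>T. p t * c \<le> p t * \<phi> t"
      using assms(2) less by (meson mult_left_mono less_imp_le)
    show "\<exists>t\<in>T. p t * c < p t * \<phi> t" using t less by (meson mult_strict_left_mono)
  qed (fact assms(1))
  thus False using assms(3,4) by (simp flip: sum_distrib_right)
qed

text \<open>A random sample of size \<open>M\<close> from \<open>p\<close>, derandomised by the method of conditional expectations.\<close>

lemma iterated_averaging:
  fixes e :: "'a \<Rightarrow> 'b \<Rightarrow> real"
  assumes "finite T" "finite X" "\<And>t. t \<in> T \<Longrightarrow> p t \<ge> 0" "(\<Sum>t\<in>T. p t) = 1"
    and e: "\<And>t x. e t x \<ge> 0" and avg: "\<And>x. x \<in> X \<Longrightarrow> (\<Sum>t\<in>T. p t * e t x) \<le> \<rho>"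
  shows "\<exists>h. (\<forall>l<M. h l \<in> T) \<and> (\<Sum>x\<in>X. \<Prod>l<M. e (h l) x) \<le> \<rho> ^ M * card X"
proof (induction M)
  case (Suc M)
  then obtain h where h: "\<forall>l<M. h l \<in> T" "(\<Sum>x\<in>X. \<Prod>l<M. e (h l) x) \<le> \<rho> ^ M * card X" by blast
  \<comment> \<open>For nonempty \<open>X\<close> a point of \<open>X\<close> shows
    \<open>\<rho> \<ge> 0\<close>; for empty \<open>X\<close> any draw will do.\<close>
  show ?case
  proof (cases "X = {}")
    case True
    have "T \<noteq> {}" using assms(4) by auto
    then obtain t where "t \<in> T" by blast
    with True show ?thesis by (intro exI[of _ "\<lambda>_. t"]) auto
  next
    case False
    then obtain x0 where "x0 \<in> X" by blast
    have "0 \<le> (\<Sum>t\<in>T. p t * e t x0)" using assms(3) e by (intro sum_nonneg) auto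
    hence "\<rho> \<ge> 0" using avg[OF \<open>x0 \<in> X\<close>] by linarith
    \<comment> \<open>The last draw is averaged with the earlier draws fixed; some outcome is at
      most the average.\<close>
    have "(\<Sum>t\<in>T. p t * (\<Sum>x\<in>X. (\<Prod>l<M. e (h l) x) * e t x)) =
        (\<Sum>x\<in>X. (\<Prod>l<M. e (h l) x) * (\<Sum>t\<in>T. p t * e t x))"
      by (simp add: sum_distrib_left mult_ac) (rule sum.swap)
    also have "\<dots> \<le> (\<Sum>x\<in>X. (\<Prod>l<M. e (h l) x) * \<rho>)"
      using avg e by (intro sum_mono mult_left_mono prod_nonneg) auto
    also have "\<dots> = \<rho> * (\<Sum>x\<in>X. \<Prod>l<M. e (h l) x)" by (simp add: sum_distrib_left mult.commute)
    also have "\<dots> \<le> \<rho> * (\<rho> ^ M * card X)" using h(2) \<open>\<rho> \<ge> 0\<close> by (rule mult_left_mono)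
    finally have avg': "(\<Sum>t\<in>T. p t * (\<Sum>x\<in>X. (\<Prod>l<M. e (h l) x) * e t x)) \<le> \<rho> ^ Suc M * card X"
      by (simp add: mult.assoc)
    obtain t where t: "t \<in> T" "(\<Sum>x\<in>X. (\<Prod>l<M. e (h l) x) * e t x) \<le> \<rho> ^ Suc M * card X"
      by (rule weighted_average_attained[OF assms(1,3,4) avg'])
    have "(\<Prod>l<Suc M. e ((h(M := t)) l) x) = (\<Prod>l<M. e (h l) x) * e t x" for x by simp
    with t h(1) show ?thesis by (intro exI[of _ "h(M := t)"]) (auto simp: less_Suc_eq)
  qed
qed simp

text \<open>For negative \<open>y\<close>, the product
  \<open>(1 + y + y^2) * (1 - y) = 1 - y^3\<close> is at least 1, and
  \<open>1 - y \<le> exp (- y)\<close>.\<close>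

lemma exp_le_quadratic:
  fixes y :: real
  assumes "y \<le> 1"
  shows "exp y \<le> 1 + y + y\<^sup>2"
proof (cases "y \<ge> 0")
  case True
  with assms exp_bound show ?thesis by auto
next
  case False
  have pos: "1 + y + y\<^sup>2 > 0"
    using zero_le_power2[of "y + 1 / 2"] by (simp add: power2_eq_square algebra_simps)
  have "y * (y * y) \<le> 0" using False by (intro mult_nonpos_nonneg) auto
  hence "1 \<le> (1 + y + y\<^sup>2) * (1 - y)" by (simp add: power2_eq_square algebra_simps)
  also have "\<dots> \<le> (1 + y + y\<^sup>2) * exp (- y)"
    using exp_ge_add_one_self[of "- y"] pos by (intro mult_left_mono) auto
  finally show ?thesis by (simp add: exp_minus field_simps)
qed

text \<open>
  Sample characters with probability proportional to the absolute values of their coefficients, so that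
  the signed sample has mean \<open>f / L\<close>. The exponential moments make a sample of size \<open>O(L\<^sup>2 n)\<close> fall on
  the right side of \<open>1 / (2 L)\<close> for all points simultaneously.
\<close>

lemma spectral_norm_sampling:
  fixes f :: "(nat \<Rightarrow> nat) \<Rightarrow> nat"
  assumes f: "\<And>x. x \<in> bool_cube n \<Longrightarrow> f x \<in> {0, 1}"
    and L: "L = spectral_norm n (\<lambda>x. real (f x))" "L \<ge> 1" and M: "real M > 64 * L\<^sup>2 * real n"
  obtains h :: "nat \<Rightarrow> nat set" and c :: "nat \<Rightarrow> real"
  where "\<And>l. l < M \<Longrightarrow> h l \<subseteq> {1..n}" "\<And>l. c l \<in> {- 1, 1}"
    "\<And>x. x \<in> bool_cube n \<Longrightarrow> f x = 1 \<Longrightarrow> (\<Sum>l<M. c l * character (h l) x) > real M / (2 * L)"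
    "\<And>x. x \<in> bool_cube n \<Longrightarrow> f x = 0 \<Longrightarrow> (\<Sum>l<M. c l * character (h l) x) < real M / (2 * L)"
proof -
  define b where "b S = fourier_coeff n (\<lambda>x. real (f x)) S" for S
  define \<sigma> :: "nat set \<Rightarrow> real" where "\<sigma> S = (if b S \<ge> 0 then 1 else - 1)" for S
  define p where "p S = \<bar>b S\<bar> / L" for S
  define \<tau> :: "(nat \<Rightarrow> nat) \<Rightarrow> real" where "\<tau> x = (if f x = 1 then 1 else - 1)" for x
  \<comment> \<open>The deviation is oriented by the value of \<open>f\<close>: a sample is on the
    correct side at \<open>x\<close> exactly when its sum of \<open>Y\<close> is negative.\<close>
  define Y where "Y S x = \<tau> x * (1 / (2 * L) - \<sigma> S * character S x)" for S x
  \<comment> \<open>This \<open>q\<close> minimises \<open>- q / (2 * L) + 4 * q^2\<close>, where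
    \<open>- 1 / (2 * L)\<close> is the mean of \<open>Y\<close> and 4 bounds its square; the
    minimum is \<open>\<rho> - 1\<close>.\<close>
  define q where "q = 1 / (16 * L)"
  define \<rho> where "\<rho> = 1 - 1 / (64 * L\<^sup>2)"
  have q: "0 < q" "q \<le> 1 / 16" using L(2) by (auto simp: q_def field_simps)
  have p1: "(\<Sum>S\<in>Pow {1..n}. p S) = 1"
    unfolding p_def sum_divide_distrib [symmetric]
    using L by (simp add: spectral_norm_def b_def)
  have Y2: "\<bar>Y S x\<bar> \<le> 2" for S x
  proof -
    have "\<bar>Y S x\<bar> \<le> \<bar>1 / (2 * L)\<bar> + \<bar>\<sigma> S * character S x\<bar>"
      using abs_triangle_ineq4[of "1 / (2 * L)" "\<sigma> S * character S x"] by (auto simp: Y_def abs_mult \<tau>_def)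
    moreover have "\<bar>\<sigma> S * character S x\<bar> = 1" by (simp add: abs_mult \<sigma>_def)
    moreover have "\<bar>1 / (2 * L)\<bar> \<le> 1" using L(2) by (simp add: field_simps)
    ultimately show ?thesis by linarith
  qed
  have avg: "(\<Sum>S\<in>Pow {1..n}. p S * exp (q * Y S x)) \<le> \<rho>" if x: "x \<in> bool_cube n" for x
  proof -
    have "(\<Sum>S\<in>Pow {1..n}. p S * (\<sigma> S * character S x)) = (\<Sum>S\<in>Pow {1..n}. b S * character S x) / L"
      unfolding sum_divide_distrib by (intro sum.cong refl) (auto simp: p_def \<sigma>_def)
    also have "\<dots> = real (f x) / L"
      using fourier_inversion[OF x, of "\<lambda>x. real (f x)"] by (simp add: b_def)
    finally have chars: "(\<Sum>S\<in>Pow {1..n}. p S * (\<sigma> S * character S x)) = real (f x) / L" .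
    have "(\<Sum>S\<in>Pow {1..n}. p S * Y S x) =
        (\<Sum>S\<in>Pow {1..n}. p S * (\<tau> x / (2 * L)) - \<tau> x * (p S * (\<sigma> S * character S x)))"
      by (intro sum.cong refl) (simp add: Y_def algebra_simps)
    also have "\<dots> = \<tau> x * (1 / (2 * L) - real (f x) / L)"
      unfolding sum_subtractf sum_distrib_right [symmetric] sum_distrib_left [symmetric] chars p1
      by (simp add: algebra_simps)
    also have "\<dots> = - 1 / (2 * L)"
      using f[OF x] L(2) by (auto simp: \<tau>_def field_simps)
    finally have mean: "(\<Sum>S\<in>Pow {1..n}. p S * Y S x) = - 1 / (2 * L)" .
    have "(\<Sum>S\<in>Pow {1..n}. p S * exp (q * Y S x)) \<le> (\<Sum>S\<in>Pow {1..n}. p S * (1 + q * Y S x + 4 * q\<^sup>2))"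
    proof (intro sum_mono mult_left_mono)
      fix S
      have "q * Y S x \<le> q * 2" using Y2[of S x] q by (intro mult_left_mono) auto
      also have "\<dots> \<le> 1" using q by simp
      finally have "exp (q * Y S x) \<le> 1 + q * Y S x + (q * Y S x)\<^sup>2"
        by (rule exp_le_quadratic)
      also have "(q * Y S x)\<^sup>2 = \<bar>Y S x\<bar>\<^sup>2 * q\<^sup>2" by (simp add: power_mult_distrib)
      also have "\<dots> \<le> 2\<^sup>2 * q\<^sup>2" using Y2 by (intro mult_right_mono power_mono) auto
      finally show "exp (q * Y S x) \<le> 1 + q * Y S x + 4 * q\<^sup>2" by simp
    qed (use L(2) in \<open>simp add: p_def\<close>)
    also have "\<dots> = (\<Sum>S\<in>Pow {1..n}. p S) * (1 + 4 * q\<^sup>2) + q * (\<Sum>S\<in>Pow {1..n}. p S * Y S x)"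
      by (simp add: algebra_simps sum.distrib sum_distrib_left sum_distrib_right)
    also have "\<dots> = \<rho>"
      unfolding p1 mean using L(2) by (simp add: q_def \<rho>_def field_simps power2_eq_square)
    finally show ?thesis .
  qed
  obtain h where h: "\<forall>l<M. h l \<in> Pow {1..n}"
    and hs: "(\<Sum>x\<in>bool_cube n. \<Prod>l<M. exp (q * Y (h l) x)) \<le> \<rho> ^ M * card (bool_cube n)"
    using iterated_averaging[of "Pow {1..n}" "bool_cube n" p "\<lambda>S x. exp (q * Y S x)" \<rho> M]
      avg p1 L(2) by (auto simp: p_def)
  \<comment> \<open>The size of \<open>M\<close> pushes \<open>\<rho> ^ M\<close> below
    \<open>exp (- n)\<close>, which outweighs the \<open>2 ^ n\<close> points since
    \<open>2 \<le> exp 1\<close>.\<close>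
  have small: "\<rho> ^ M * card (bool_cube n) < 1"
  proof -
    have "1 \<le> L\<^sup>2" using L(2) by simp
    hence "1 / (64 * L\<^sup>2) \<le> 1 / 1" by (intro frac_le) auto
    hence "0 \<le> \<rho>" by (simp add: \<rho>_def)
    moreover have "\<rho> \<le> exp (- (1 / (64 * L\<^sup>2)))"
      using exp_ge_add_one_self[of "- (1 / (64 * L\<^sup>2))"] by (simp add: \<rho>_def)
    ultimately have "\<rho> ^ M \<le> exp (- (1 / (64 * L\<^sup>2))) ^ M" by (intro power_mono)
    also have "\<dots> = exp (- (real M / (64 * L\<^sup>2)))" by (simp flip: exp_of_nat_mult)
    also have "\<dots> < exp (- real n)" using M L(2) by (simp add: field_simps)
    also have "\<dots> = (1 / exp 1) ^ n" by (simp add: exp_minus power_one_over inverse_eq_divide flip: exp_of_nat_mult)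
    finally have "\<rho> ^ M * 2 ^ n < (1 / exp 1) ^ n * 2 ^ n" by simp
    also have "\<dots> = (2 / exp 1) ^ n" by (simp add: power_divide)
    also have "\<dots> \<le> 1" using exp_ge_add_one_self[of 1] by (intro power_le_one) auto
    finally show ?thesis by (simp add: card_bool_cube)
  qed
  \<comment> \<open>A sum of nonnegative terms is below 1, hence so is each term, and its exponent
    is negative.\<close>
  have neg: "(\<Sum>l<M. Y (h l) x) < 0" if x: "x \<in> bool_cube n" for x
  proof -
    have "exp (q * (\<Sum>l<M. Y (h l) x)) = (\<Prod>l<M. exp (q * Y (h l) x))"
      by (simp add: exp_sum sum_distrib_left)
    also have "\<dots> \<le> (\<Sum>x\<in>bool_cube n. \<Prod>l<M. exp (q * Y (h l) x))"
      using x by (intro member_le_sum prod_nonneg) auto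
    also have "\<dots> < 1" using hs small by linarith
    finally show ?thesis using q by (simp add: mult_less_0_iff)
  qed
  have Ysum: "(\<Sum>l<M. Y (h l) x) = \<tau> x * (real M / (2 * L) - (\<Sum>l<M. \<sigma> (h l) * character (h l) x))" for x
    by (simp add: Y_def sum_subtractf flip: sum_distrib_left)
  show ?thesis
  proof (rule that[of h "\<lambda>l. \<sigma> (h l)"])
    fix x assume "x \<in> bool_cube n" "f x = 1"
    with neg[of x] show "(\<Sum>l<M. \<sigma> (h l) * character (h l) x) > real M / (2 * L)"
      unfolding Ysum by (simp add: \<tau>_def)
  next
    fix x assume "x \<in> bool_cube n" "f x = 0"
    with neg[of x] show "(\<Sum>l<M. \<sigma> (h l) * character (h l) x) < real M / (2 * L)"
      unfolding Ysum by (simp add: \<tau>_def)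
  qed (use h in \<open>auto simp: \<sigma>_def\<close>)
qed

text \<open>The sample of signed characters becomes a majority of parities and negated parities,
  with constant inputs moving the threshold to the integer part of
  \<open>M / (2 * L)\<close>.\<close>

lemma PL_1_subset_PT_1_hat: "PL_1 \<subseteq> PT_1_hat"
proof
  fix F assume "F \<in> PL_1"
  then obtain N f p where F: "F = (N, f)" "(N, f) \<in> bool_families"
    and p: "\<And>k. k \<ge> 1 \<Longrightarrow> spectral_norm (N k) (\<lambda>x. real (f k x)) \<le> poly p (real (N k))"
    unfolding PL_1_def spectral_norm_def by auto
  \<comment> \<open>The gate has \<open>M + C \<le> 2 * M\<close> inputs and
    \<open>M \<le> 64 * L^2 * n + 1\<close>.\<close>
  define p' :: "real poly" where "p' = 128 * p\<^sup>2 * [:0, 1:] + 4"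
  have "\<exists>m g. real m \<le> poly p' (real (N k)) \<and> (\<forall>j\<in>{1..m}. g j \<in> maj_inputs (N k)) \<and>
       (\<forall>x\<in>bool_cube (N k). f k x = maj m (\<lambda>j. g j x))" if k: "k \<ge> 1" for k
  proof -
    define n where "n = N k"
    define L where "L = spectral_norm n (\<lambda>x. real (f k x))"
    have f: "f k x \<in> {0, 1}" if "x \<in> bool_cube n" for x
      using F(2) k that unfolding bool_families_def n_def by auto
    show ?thesis
    proof (cases "\<forall>x\<in>bool_cube n. f k x = 0")
      case True
      thus ?thesis
        by (intro exI[of _ 0]) (auto simp: maj_def threshold_sign_def p'_def n_def)
    next
      case False
      then obtain y where y: "y \<in> bool_cube n" "f k y = 1" using f by fastforce
      \<comment> \<open>Sampling requires \<open>L \<ge> 1\<close>; inversion at the point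
        \<open>y\<close> of value 1 supplies it. The zero function was handled by an empty
        gate.\<close>
      have "1 = (\<Sum>S\<in>Pow {1..n}. fourier_coeff n (\<lambda>x. real (f k x)) S * character S y)"
        using fourier_inversion[OF y(1), of "\<lambda>x. real (f k x)"] y(2) by simp
      also have "\<dots> \<le> L"
        unfolding L_def spectral_norm_def
      proof (rule sum_mono)
        fix S
        show "fourier_coeff n (\<lambda>x. real (f k x)) S * character S y \<le> \<bar>fourier_coeff n (\<lambda>x. real (f k x)) S\<bar>"
          by (rule order_trans[OF abs_ge_self]) (simp add: abs_mult)
      qed
      finally have L1: "L \<ge> 1" .
      define M where "M = nat \<lfloor>64 * L\<^sup>2 * real n\<rfloor> + 1"
      define C where "C = nat \<lfloor>real M / (2 * L)\<rfloor>"
      have M: "real M > 64 * L\<^sup>2 * real n" unfolding M_def by linarith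
      obtain h c where h: "\<And>l. l < M \<Longrightarrow> h l \<subseteq> {1..n}" and c: "\<And>l. c l \<in> {- 1, 1}"
        and pos: "\<And>x. x \<in> bool_cube n \<Longrightarrow> f k x = 1 \<Longrightarrow> (\<Sum>l<M. c l * character (h l) x) > real M / (2 * L)"
        and neg: "\<And>x. x \<in> bool_cube n \<Longrightarrow> f k x = 0 \<Longrightarrow> (\<Sum>l<M. c l * character (h l) x) < real M / (2 * L)"
        using spectral_norm_sampling[of n "f k" L M, OF f L_def L1 M] by blast
      \<comment> \<open>Since \<open>(1 + \<chi>) / 2\<close> is the negated parity and
        \<open>(1 - \<chi>) / 2\<close> the parity, sign 1 asks for negation. The \<open>C\<close>
        zero inputs raise the threshold to \<open>(M + C) / 2\<close>.\<close>
      define g where "g j = (if j \<le> M then if c (j - 1) = 1 then \<lambda>x. 1 - parity_of (h (j - 1)) x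
          else parity_of (h (j - 1)) else (\<lambda>x. 0))" for j
      have g: "g j \<in> maj_inputs n" if "j \<in> {1..M + C}" for j
      proof (cases "j \<le> M")
        case True
        with that have "h (j - 1) \<subseteq> {1..n}" by (intro h) auto
        with True show ?thesis unfolding maj_inputs_def g_def by auto
      qed (simp add: maj_inputs_def g_def)
      have par: "parity_of S x \<le> 1" for S x unfolding parity_of_def by linarith
      have "f k x = maj (M + C) (\<lambda>j. g j x)" if x: "x \<in> bool_cube n" for x
      proof -
        define X where "X = (\<Sum>l<M. c l * character (h l) x)"
        have "(\<Sum>j=1..M + C. real (g j x)) = (\<Sum>j=1..M. real (g j x))"
          by (intro sum.mono_neutral_right) (auto simp: g_def)
        also have "\<dots> = (\<Sum>l<M. real (g (Suc l) x))"
          by (simp add: sum.atLeast1_atMost_eq)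
        also have "\<dots> = (\<Sum>l<M. 1 / 2 + c l * character (h l) x / 2)"
        proof (rule sum.cong)
          fix l assume "l \<in> {..<M}"
          thus "real (g (Suc l) x) = 1 / 2 + c l * character (h l) x / 2"
            using c[of l] par[of "h l" x] by (auto simp: g_def character_parity of_nat_diff field_simps)
        qed simp
        also have "\<dots> = real M / 2 + X / 2"
          by (simp add: sum.distrib X_def flip: sum_divide_distrib)
        finally have sum: "(\<Sum>j=1..M + C. real (g j x)) - real (M + C) / 2 = (X - real C) / 2" 
          by (simp add: field_simps)
        \<comment> \<open>Integrality of \<open>X\<close> lets the real threshold be rounded down to
          \<open>C\<close>; equality \<open>X = C\<close> is rejected, as it should be.\<close>
        have "\<exists>z::int. X = of_int z"
        proof -
          have "c l * character (h l) x \<in> \<int>" for l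
            using c[of l] by (auto simp: character_parity)
          hence "X \<in> \<int>" unfolding X_def by (intro Ints_sum) auto
          thus ?thesis by (auto elim: Ints_cases)
        qed
        then obtain z :: int where z: "X = of_int z" by blast
        have C: "real C = of_int \<lfloor>real M / (2 * L)\<rfloor>" using L1 by (simp add: C_def)
        show ?thesis
        proof (cases "f k x = 1")
          case True
          with pos[OF x] have "X > real C" unfolding X_def C by linarith
          thus ?thesis unfolding True maj_def sum by (simp add: threshold_sign_def)
        next
          case False
          hence zero: "f k x = 0" using f[OF x] by auto
          with neg[OF x] have "of_int z < real M / (2 * L)" unfolding X_def [symmetric] z by simp
          hence "z \<le> \<lfloor>real M / (2 * L)\<rfloor>" by (simp add: le_floor_iff)
          hence "X \<le> real C" unfolding C z by simp
          thus ?thesis unfolding zero maj_def sum by (simp add: threshold_sign_def)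
        qed
      qed
      moreover have "real (M + C) \<le> poly p' (real (N k))"
      proof -
        have "real M / (2 * L) \<le> real M / 1" using L1 by (intro frac_le) auto
        hence "real C \<le> real M" using L1 by (simp add: C_def) linarith
        moreover have "real M \<le> 64 * L\<^sup>2 * real n + 1"
          unfolding M_def using zero_le_mult_iff[of "64 * L\<^sup>2" "real n"] by (simp add: of_nat_nat)
        moreover have "L\<^sup>2 * real n \<le> (poly p (real n))\<^sup>2 * real n"
          using p[OF k] L1 by (intro mult_right_mono power_mono) (auto simp: L_def n_def)
        ultimately show ?thesis by (simp add: p'_def n_def algebra_simps)
      qed
      ultimately show ?thesis using g unfolding n_def by (intro exI[of _ "M + C"] exI[of _ g]) auto
    qed
  qed
  with F show "F \<in> PT_1_hat" unfolding PT_1_hat_def by auto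
qed

subsection \<open>The complete quadratic function\<close>

definition hamming_weight :: "nat \<Rightarrow> (nat \<Rightarrow> nat) \<Rightarrow> nat" where
  "hamming_weight n x = (\<Sum>i=1..n. x i)"

lemma hamming_weight_le: "x \<in> bool_cube n \<Longrightarrow> hamming_weight n x \<le> n"
  unfolding hamming_weight_def
  using sum_bounded_above[of "{1..n}" x 1] bool_cube_bit[of x n] by fastforce

text \<open>The binomial coefficient counts pairs of ones, so the value is the sum of all products
  of two distinct variables modulo 2.\<close>

definition complete_quadratic :: bool_family where
  "complete_quadratic = (\<lambda>k. k, \<lambda>k x. (hamming_weight k x choose 2) mod 2)"

text \<open>Both sides have period 4 in \<open>w\<close>. Powers of \<open>\<i>\<close> are
  multiplicative in the coordinates, which the left side is not.\<close>

lemma sign_choose_two: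
  "2 * real ((w choose 2) mod 2) - 1 = - Re ((1 - \<i>) * \<i> ^ w)"
proof (induction w rule: less_induct)
  case (less w)
  consider "w = 0" | "w = 1" | "w = 2" | "w = 3" | v where "w = v + 4"
  proof (cases "w < 4")
    case True
    hence "w = 0 \<or> w = 1 \<or> w = 2 \<or> w = 3" by linarith
    thus ?thesis using that by blast
  next
    case False
    thus ?thesis using that(5)[of "w - 4"] by simp
  qed
  thus ?case
  proof cases
    fix v assume v: "w = v + 4"
    have "(w choose 2) = (v choose 2) + 2 * (2 * v + 3)"
      unfolding v by (simp add: numeral_eq_Suc)
    hence "(w choose 2) mod 2 = (v choose 2) mod 2" by presburger
    moreover have "\<i> ^ w = \<i> ^ v" unfolding v by (simp add: power_add numeral_eq_Suc)
    ultimately show ?thesis using less[of v] v by simp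
  qed (auto simp: choose_two power3_eq_cube)
qed

text \<open>As the real part of a product over coordinates, the sum factors. Each coordinate gives
  \<open>1 + \<i>\<close> or \<open>1 - \<i>\<close>, of modulus \<open>sqrt 2\<close>, and the
  prefactor \<open>1 - \<i>\<close> gives one more \<open>sqrt 2\<close>.\<close>

lemma complete_quadratic_correlation:
  assumes "D \<subseteq> {1..n}"
  shows "\<bar>\<Sum>x\<in>bool_cube n. (2 * real ((hamming_weight n x choose 2) mod 2) - 1) * character D x\<bar>
    \<le> sqrt 2 * sqrt 2 ^ n"
proof -
  define g :: "nat \<Rightarrow> nat \<Rightarrow> complex" where "g i b = \<i> ^ b * (if i \<in> D then (- 1) ^ b else 1)" for i b
  have "(2 * real ((hamming_weight n x choose 2) mod 2) - 1) * character D x =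
      - Re ((1 - \<i>) * (\<Prod>i=1..n. g i (x i)))" for x
  proof -
    have "(\<Prod>i=1..n. g i (x i)) = \<i> ^ hamming_weight n x * (\<Prod>i=1..n. of_real (if i \<in> D then (- 1) ^ x i else 1))"
      by (auto simp: g_def prod.distrib hamming_weight_def power_sum intro!: prod.cong)
    also have "\<dots> = \<i> ^ hamming_weight n x * of_real (character D x)"
      by (simp only: of_real_prod character_extend[OF assms])
    finally show ?thesis by (simp only: sign_choose_two) (simp add: algebra_simps)
  qed
  hence "(\<Sum>x\<in>bool_cube n. (2 * real ((hamming_weight n x choose 2) mod 2) - 1) * character D x) =
      - Re ((1 - \<i>) * (\<Sum>x\<in>bool_cube n. \<Prod>i=1..n. g i (x i)))"
    by (simp only: sum_negf Re_sum sum_distrib_left)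
  also have "(\<Sum>x\<in>bool_cube n. \<Prod>i=1..n. g i (x i)) = (\<Prod>i=1..n. g i 0 + g i 1)"
    by (rule sum_bool_cube_prod)
  also have "\<bar>- Re ((1 - \<i>) * (\<Prod>i=1..n. g i 0 + g i 1))\<bar> \<le> cmod ((1 - \<i>) * (\<Prod>i=1..n. g i 0 + g i 1))"
    unfolding abs_minus_cancel by (rule abs_Re_le_cmod)
  also have "\<dots> = sqrt 2 * sqrt 2 ^ n"
  proof -
    have "cmod (g i 0 + g i 1) = sqrt 2" for i by (simp add: g_def cmod_def)
    thus ?thesis by (simp add: norm_mult flip: prod_norm) (simp add: cmod_def)
  qed
  finally show ?thesis .
qed

lemma complete_quadratic_not_in_PT_1: "complete_quadratic \<notin> PT_1"
proof
  assume "complete_quadratic \<in> PT_1"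
  then obtain p where p: "\<And>k. k \<ge> 1 \<Longrightarrow> \<exists>m w S. real m \<le> poly p (real k) \<and>
      (\<forall>j\<in>{1..m}. S j \<subseteq> {1..k}) \<and>
      (\<forall>x\<in>bool_cube k. (hamming_weight k x choose 2) mod 2 = ltf m w (\<lambda>j. parity_of (S j) x))"
    unfolding PT_1_def complete_quadratic_def by auto
  \<comment> \<open>The polynomial is what squaring \<open>sqrt 2 ^ k \<le> (m + 1) * sqrt 2\<close>
    yields; \<open>k \<ge> 2\<close> leaves room for an accepted point \<open>y\<close> of weight
    2.\<close>
  obtain k where k: "k \<ge> 2" "poly (2 * (p + 1) ^ 2) (real k) < 2 ^ k"
    using poly_less_two_power by blast
  obtain m w S where m: "real m \<le> poly p (real k)" and S: "\<forall>j\<in>{1..m}. S j \<subseteq> {1..k}"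
    and f: "\<forall>x\<in>bool_cube k. (hamming_weight k x choose 2) mod 2 = ltf m w (\<lambda>j. parity_of (S j) x)"
    using p[of k] k by auto
  define y where "y = (\<lambda>i\<in>{1..k}. if i \<in> {1,2} then 1 else 0 :: nat)"
  have y: "y \<in> bool_cube k" by (auto simp: y_def bool_cube_def)
  have "hamming_weight k y = (\<Sum>i\<in>{1..k}. if i \<in> {1,2} then 1 else 0)"
    unfolding hamming_weight_def by (intro sum.cong) (auto simp: y_def)
  also have "\<dots> = (\<Sum>i\<in>{1,2::nat}. 1)" using k by (intro sum.mono_neutral_cong_right) auto
  also have "\<dots> = 2" by simp
  finally have "(hamming_weight k y choose 2) mod 2 = 1" by simp
  hence "2 ^ k \<le> (real m + 1) * (sqrt 2 * sqrt 2 ^ k)"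
    using S f complete_quadratic_correlation
    by (intro threshold_of_parities_correlation[where f = "\<lambda>x. (hamming_weight k x choose 2) mod 2"
        and w = w and S = S, OF _ _ y]) blast+
  moreover have sq: "(2 :: real) ^ k = sqrt 2 ^ k * sqrt 2 ^ k"
    by (simp flip: power_mult_distrib)
  ultimately have "sqrt 2 ^ k * sqrt 2 ^ k \<le> ((real m + 1) * sqrt 2) * sqrt 2 ^ k"
    by (simp only: mult.assoc)
  hence "sqrt 2 ^ k \<le> (real m + 1) * sqrt 2"
    by (rule mult_right_le_imp_le) simp
  hence "sqrt 2 ^ k * sqrt 2 ^ k \<le> ((real m + 1) * sqrt 2) * ((real m + 1) * sqrt 2)"
    by (intro mult_mono) auto
  also have "\<dots> = (sqrt 2)\<^sup>2 * (real m + 1) ^ 2" by (simp only: power2_eq_square mult_ac)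
  also have "\<dots> = 2 * (real m + 1) ^ 2" by simp
  finally have "2 ^ k \<le> 2 * (real m + 1) ^ 2" unfolding sq .
  also have "\<dots> \<le> 2 * (poly p (real k) + 1) ^ 2" using m by (intro mult_left_mono power_mono) auto
  finally show False using k by (simp add: algebra_simps)
qed

section \<open>Short decision lists with small weights\<close>

lemma LDL_hatI:
  assumes "(N, f) \<in> bool_families"
    and "\<And>k. computes_ldl (N k) (s k) (W k) (a k) (f k)"
    and "\<And>k. real (s k) \<le> poly p (real (N k))"
    and "\<And>k. \<forall>i\<in>{1..s k}. \<forall>j\<in>{0..N k}. W k i j \<in> \<int> \<and> \<bar>W k i j\<bar> \<le> poly q (real (N k))"
  shows "(N, f) \<in> LDL_hat"
  unfolding LDL_hat_def using assms by blast

text \<open>Query \<open>i\<close> asks whether the weight exceeds \<open>k - i\<close>, so the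
  first query to accept reveals the weight as \<open>k + 1 - i\<close>. Query \<open>k + 1\<close>
  catches weight 0.\<close>

lemma complete_quadratic_in_LDL_hat: "complete_quadratic \<in> LDL_hat"
proof -
  have fam: "complete_quadratic \<in> bool_families"
    by (auto simp: complete_quadratic_def bool_families_def strict_mono_on_def)
  have "computes_ldl k (k + 1) (\<lambda>i j. if j = 0 then real i - real k else 1)
      (\<lambda>i. (k + 1 - i choose 2) mod 2) (\<lambda>x. (hamming_weight k x choose 2) mod 2)" for k
    unfolding computes_ldl_def
  proof (intro conjI ballI)
    let ?W = "\<lambda>i j. if j = 0 then real i - real k else 1"
    have query: "ltf k (?W i) x = 1 \<longleftrightarrow> k < i + hamming_weight k x" for i x
    proof -
      have "?W i 0 + (\<Sum>j=1..k. ?W i j * real (x j)) = real i - real k + real (hamming_weight k x)"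
        by (simp add: hamming_weight_def)
      thus ?thesis by (auto simp: ltf_def threshold_sign_def)
    qed
    fix x assume x: "x \<in> bool_cube k"
    show "ltf k (?W (k + 1)) x = 1" unfolding query by simp
    have "(LEAST i. i \<in> {1..k + 1} \<and> ltf k (?W i) x = 1) = k + 1 - hamming_weight k x"
      unfolding query using hamming_weight_le[OF x] by (intro Least_equality) auto
    thus "(hamming_weight k x choose 2) mod 2 =
      (k + 1 - (LEAST i. i \<in> {1..k + 1} \<and> ltf k (?W i) x = 1) choose 2) mod 2"
      using hamming_weight_le[OF x] by simp
  qed auto
  moreover have "real (k + 1) \<le> poly [:1, 1:] (real k)" for k by simp
  moreover have "\<forall>i\<in>{1..k + 1}. \<forall>j\<in>{0..k}. (if j = 0 then real i - real k else 1) \<in> \<int> \<and>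
      \<bar>if j = 0 then real i - real k else 1\<bar> \<le> poly [:1, 1:] (real k)" for k
    by auto
  ultimately show ?thesis
    using fam unfolding complete_quadratic_def by (intro LDL_hatI)
qed

definition zero_family :: bool_family where
  "zero_family = (\<lambda>k. k, \<lambda>k x. 0)"

lemma zero_family_in_LDL_hat: "zero_family \<in> LDL_hat"
proof -
  have "zero_family \<in> bool_families"
    by (auto simp: zero_family_def bool_families_def strict_mono_on_def)
  moreover have "computes_ldl k 1 (\<lambda>i j. if j = 0 then 1 else 0) (\<lambda>i. 0) (\<lambda>x. 0)" for k
    by (simp add: computes_ldl_def ltf_def threshold_sign_def)
  moreover have "real 1 \<le> poly [:1:] (real k)" for k by simp
  moreover have "\<forall>i\<in>{1..1}. \<forall>j\<in>{0..k}. (if j = 0 then 1 else 0 :: real) \<in> \<int> \<and>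
      \<bar>if j = 0 then 1 else 0 :: real\<bar> \<le> poly [:1:] (real k)" for k :: nat
    by auto
  ultimately show ?thesis
    unfolding zero_family_def by (intro LDL_hatI)
qed

text \<open>All coefficients vanish, while the required lower bound is positive; the index 1 already
  shows this.\<close>

lemma zero_family_not_in_PL_inf: "zero_family \<notin> PL_inf"
proof
  assume "zero_family \<in> PL_inf"
  then obtain p :: "real poly" where "poly p (real 1) > 0"
    "Max ((\<lambda>S. \<bar>fourier_coeff 1 (\<lambda>x. real 0) S\<bar>) ` Pow {1..1}) \<ge> 1 / poly p (real 1)"
    unfolding PL_inf_def zero_family_def by blast
  moreover have "(\<lambda>S. \<bar>fourier_coeff 1 (\<lambda>x. real 0) S\<bar>) ` Pow {1..1} = {0}"
    by (auto simp: fourier_coeff_def)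
  ultimately show False by simp
qed

lemma LDL_hat_subset_LDL: "LDL_hat \<subseteq> LDL"
  unfolding LDL_hat_def LDL_def by blast

subsection \<open>Rectangles and decision lists\<close>

text \<open>Maximal elements are taken greedily. Comparing \<open>T\<close> with its complement
  instead of fixing a cutoff value allows an exact size in the presence of ties.\<close>

lemma top_subset:
  fixes u :: "'a \<Rightarrow> real"
  assumes "finite A" "c \<le> card A"
  shows "\<exists>T\<subseteq>A. card T = c \<and> (\<forall>x\<in>T. \<forall>y\<in>A - T. u y \<le> u x)"
  using assms(2)
proof (induction c)
  case (Suc c)
  then obtain T where T: "T \<subseteq> A" "card T = c" "\<forall>x\<in>T. \<forall>y\<in>A - T. u y \<le> u x" by auto
  have "A - T \<noteq> {}" using T Suc.prems card_mono[of T A] assms(1) finite_subset by fastforce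
  hence "Max (u ` (A - T)) \<in> u ` (A - T)" using assms(1) by (intro Max_in) auto
  then obtain z where z: "z \<in> A - T" "u z = Max (u ` (A - T))" by force
  have le_z: "u y \<le> u z" if "y \<in> A - T" for y unfolding z(2) using assms(1) that by (intro Max_ge) auto
  have "finite T" using T assms(1) finite_subset by blast
  hence "card (insert z T) = Suc c" using T z by simp
  moreover have "u y \<le> u x" if "x \<in> insert z T" "y \<in> A - insert z T" for x y
    using that T(3) le_z by blast
  ultimately show ?case using T(1) z(1) by (intro exI[of _ "insert z T"]) blast
qed auto

text \<open>
  Ordering rows by \<open>u\<close> and columns by \<open>v\<close>, a query \<open>u x + v y > 0\<close> either accepts the whole
  rectangle of the \<open>c\<close> top rows and \<open>d\<close> top columns, or rejects everything outside these rows and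
  columns; in the second case discard them and pass to the next query.
\<close>

lemma decision_list_monochromatic_rectangle:
  fixes u :: "nat \<Rightarrow> 'a \<Rightarrow> real" and v :: "nat \<Rightarrow> 'b \<Rightarrow> real"
  assumes fin: "finite A" "finite B" and s: "s \<ge> 1" "s * c \<le> card A" "s * d \<le> card B"
    and last: "\<And>x y. x \<in> A \<Longrightarrow> y \<in> B \<Longrightarrow> u s x + v s y > 0"
    and f: "\<And>x y. x \<in> A \<Longrightarrow> y \<in> B \<Longrightarrow> f x y = a (LEAST i. i \<in> {1..s} \<and> u i x + v i y > 0)"
  obtains A' B' b where "A' \<subseteq> A" "B' \<subseteq> B" "card A' = c" "card B' = d"
    "\<forall>x\<in>A'. \<forall>y\<in>B'. f x y = b"
proof -
  define mono where "mono \<longleftrightarrow> (\<exists>A' B' b. A' \<subseteq> A \<and> B' \<subseteq> B \<and> card A' = c \<and> card B' = d \<and>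
    (\<forall>x\<in>A'. \<forall>y\<in>B'. f x y = b))"
  have monoI: mono
    if "A' \<subseteq> A" "B' \<subseteq> B" "card A' = c" "card B' = d" "\<forall>x\<in>A'. \<forall>y\<in>B'. f x y = b" for A' B' b
    unfolding mono_def using that by blast
  have first: "f x y = a (Suc t)"
    if "x \<in> A" "y \<in> B" "t < s" "\<forall>i\<in>{1..t}. u i x + v i y \<le> 0" "u (Suc t) x + v (Suc t) y > 0" for x y t
  proof -
    have "(LEAST i. i \<in> {1..s} \<and> u i x + v i y > 0) = Suc t"
    proof (rule Least_equality)
      fix i assume i: "i \<in> {1..s} \<and> u i x + v i y > 0"
      show "Suc t \<le> i"
      proof (rule ccontr)
        assume "\<not> Suc t \<le> i"
        with i that(4) show False by (auto simp: not_le dest: bspec[of _ _ i])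
      qed
    qed (use that in auto)
    thus ?thesis using f that by simp
  qed
  \<comment> \<open>Invariant: either a monochromatic rectangle was found, or the first
    \<open>t\<close> queries reject a rectangle obtained by deleting at most \<open>t * c\<close>
    rows and \<open>t * d\<close> columns.\<close>
  have "mono \<or> (\<exists>A1\<subseteq>A. \<exists>B1\<subseteq>B. card A \<le> card A1 + t * c \<and> card B \<le> card B1 + t * d \<and>
      (\<forall>i\<in>{1..t}. \<forall>x\<in>A1. \<forall>y\<in>B1. u i x + v i y \<le> 0))" if "t < s" for t
    using that
  proof (induction t)
    case 0
    show ?case by (intro disjI2 exI[of _ A] conjI exI[of _ B]) auto
  next
    case (Suc t)
    show ?case
    proof (cases mono)
      case False
      with Suc obtain A1 B1 where A1: "A1 \<subseteq> A" "card A \<le> card A1 + t * c"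
        and B1: "B1 \<subseteq> B" "card B \<le> card B1 + t * d"
        and rej: "\<forall>i\<in>{1..t}. \<forall>x\<in>A1. \<forall>y\<in>B1. u i x + v i y \<le> 0" by auto
      have fin1: "finite A1" "finite B1" using A1 B1 fin finite_subset by blast+
      have "Suc t * c \<le> s * c" "Suc t * d \<le> s * d" using Suc.prems by (intro mult_right_mono; simp)+
      hence "c \<le> card A1" "d \<le> card B1" using A1 B1 s by auto
      then obtain TA TB where TA: "TA \<subseteq> A1" "card TA = c" "\<forall>x\<in>TA. \<forall>y\<in>A1 - TA. u (Suc t) y \<le> u (Suc t) x"
        and TB: "TB \<subseteq> B1" "card TB = d" "\<forall>x\<in>TB. \<forall>y\<in>B1 - TB. v (Suc t) y \<le> v (Suc t) x"
        using top_subset[OF fin1(1), of c "u (Suc t)"] top_subset[OF fin1(2), of d "v (Suc t)"] by blast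
      have "\<not> (\<forall>x\<in>TA. \<forall>y\<in>TB. u (Suc t) x + v (Suc t) y > 0)"
      proof
        assume acc: "\<forall>x\<in>TA. \<forall>y\<in>TB. u (Suc t) x + v (Suc t) y > 0"
        have "\<forall>x\<in>TA. \<forall>y\<in>TB. f x y = a (Suc t)"
        proof (intro ballI)
          fix x y assume "x \<in> TA" "y \<in> TB"
          moreover from this have "x \<in> A1" "y \<in> B1" using TA TB by auto
          ultimately show "f x y = a (Suc t)"
            using A1(1) B1(1) rej acc Suc.prems by (intro first) auto
        qed
        hence mono using TA TB A1 B1 by (intro monoI[of TA TB]) auto
        with False show False by simp
      qed
      then obtain x0 y0 where xy: "x0 \<in> TA" "y0 \<in> TB" "u (Suc t) x0 + v (Suc t) y0 \<le> 0"
        by (auto simp: not_less)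
      have rej': "\<forall>i\<in>{1..Suc t}. \<forall>x\<in>A1 - TA. \<forall>y\<in>B1 - TB. u i x + v i y \<le> 0"
      proof (intro ballI)
        fix i x y assume i: "i \<in> {1..Suc t}" and x: "x \<in> A1 - TA" and y: "y \<in> B1 - TB"
        show "u i x + v i y \<le> 0"
        proof (cases "i = Suc t")
          case True
          have "u i x \<le> u i x0" "v i y \<le> v i y0" using TA TB x y xy True by auto
          thus ?thesis using xy True by simp
        qed (use rej i x y in auto)
      qed
      have "card (A1 - TA) = card A1 - c" "card (B1 - TB) = card B1 - d"
        using TA TB fin1 by (auto simp: card_Diff_subset finite_subset)
      hence "card A \<le> card (A1 - TA) + Suc t * c" "card B \<le> card (B1 - TB) + Suc t * d"
        using A1 B1 by auto
      with rej' A1 B1 show ?thesis by (intro disjI2 exI[of _ "A1 - TA"] exI[of _ "B1 - TB"] conjI) auto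
    qed auto
  qed
  \<comment> \<open>After \<open>s - 1\<close> rejections enough rows and columns remain, and the
    last query accepts all of them with the single output \<open>a s\<close>.\<close>
  from this[of "s - 1"] have mono
  proof
    assume "\<exists>A1\<subseteq>A. \<exists>B1\<subseteq>B. card A \<le> card A1 + (s - 1) * c \<and> card B \<le> card B1 + (s - 1) * d \<and>
      (\<forall>i\<in>{1..s - 1}. \<forall>x\<in>A1. \<forall>y\<in>B1. u i x + v i y \<le> 0)"
    then obtain A1 B1 where A1: "A1 \<subseteq> A" "card A \<le> card A1 + (s - 1) * c"
      and B1: "B1 \<subseteq> B" "card B \<le> card B1 + (s - 1) * d"
      and rej: "\<forall>i\<in>{1..s - 1}. \<forall>x\<in>A1. \<forall>y\<in>B1. u i x + v i y \<le> 0" by auto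
    have "s * c = (s - 1) * c + c" "s * d = (s - 1) * d + d" using s(1) by (cases s; simp)+
    hence "c \<le> card A1" "d \<le> card B1" using A1 B1 s by auto
    then obtain A' B' where A': "A' \<subseteq> A1" "card A' = c" and B': "B' \<subseteq> B1" "card B' = d"
      by (meson obtain_subset_with_card_n)
    have "f x y = a s" if "x \<in> A'" "y \<in> B'" for x y
      using first[of x y "s - 1"] that A1 B1 A' B' s(1) rej last by (auto simp: subset_iff)
    with A1 B1 A' B' show mono by (intro monoI[of A' B']) auto
  qed (use s in auto)
  thus ?thesis using that unfolding mono_def by blast
qed

section \<open>Shearer's inequality for double covers\<close>

text \<open>The cross term obeys \<open>a * b \<le> R * (p * q' + p' * q) / 2\<close> by the
  inequality of arithmetic and geometric means, matching the cross terms on the right.\<close>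

lemma shearer_two_fibres:
  fixes a b p q p' q' R :: real
  assumes "0 \<le> p" "0 \<le> q" "0 \<le> p'" "0 \<le> q'" "0 \<le> R" "0 \<le> a" "0 \<le> b"
    and "a\<^sup>2 \<le> p * q * R" "b\<^sup>2 \<le> p' * q' * R"
  shows "(a + b)\<^sup>2 \<le> (p + p') * (q + q') * R"
proof -
  have "(a * b)\<^sup>2 \<le> (p * q * R) * (p' * q' * R)"
    unfolding power_mult_distrib using assms by (intro mult_mono) auto
  also have "\<dots> = R\<^sup>2 * ((p * q') * (p' * q))" by (simp add: power2_eq_square)
  also have "\<dots> \<le> R\<^sup>2 * ((p * q' + p' * q) / 2)\<^sup>2"
  proof (rule mult_left_mono)
    have "0 \<le> (p * q' - p' * q)\<^sup>2" by simp
    thus "(p * q') * (p' * q) \<le> ((p * q' + p' * q) / 2)\<^sup>2"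
      by (simp add: power2_eq_square field_simps)
  qed simp
  finally have "(a * b)\<^sup>2 \<le> (R * ((p * q' + p' * q) / 2))\<^sup>2" by (simp only: power_mult_distrib)
  hence "a * b \<le> R * ((p * q' + p' * q) / 2)"
    by (rule power2_le_imp_le) (use assms in auto)
  with assms(8,9) show ?thesis by (simp add: power2_eq_square algebra_simps)
qed

text \<open>
  Split the family by membership of the new point \<open>e\<close>. The two parts have disjoint traces on the two
  sets \<open>F j\<close>, \<open>F l\<close> containing \<open>e\<close>, where Cauchy--Schwarz applies; on the other sets it is enough
  that their traces do not exceed that of the family.
\<close>

lemma shearer_double_cover:
  assumes "finite E" "finite I" "\<A> \<subseteq> Pow E"
    and "\<And>e. e \<in> E \<Longrightarrow> \<exists>j\<in>I. \<exists>l\<in>I. j \<noteq> l \<and> e \<in> F j \<and> e \<in> F l"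
  shows "(real (card \<A>))\<^sup>2 \<le> (\<Prod>i\<in>I. real (card ((\<lambda>x. x \<inter> F i) ` \<A>)))"
  using assms(1,3,4)
proof (induction E arbitrary: \<A> rule: finite_induct)
  case empty
  hence "\<A> = {} \<or> \<A> = {{}}" by auto
  thus ?case by (auto intro: prod_nonneg)
next
  case (insert e E)
  define \<B> where "\<B> = {x \<in> \<A>. e \<notin> x}"
  define \<C> where "\<C> = (\<lambda>x. x - {e}) ` {x \<in> \<A>. e \<in> x}"
  have sub: "\<B> \<subseteq> Pow E" "\<C> \<subseteq> Pow E" using insert.prems(1) by (auto simp: \<B>_def \<C>_def)
  have finA: "finite \<A>" using insert finite_subset by (metis finite.insertI finite_Pow_iff)
  have cardC: "card \<C> = card {x \<in> \<A>. e \<in> x}"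
    unfolding \<C>_def by (intro card_image inj_onI) (metis (mono_tags) insert_Diff mem_Collect_eq)
  have "\<A> = \<B> \<union> {x \<in> \<A>. e \<in> x}" by (auto simp: \<B>_def)
  hence cardA: "card \<A> = card \<B> + card \<C>"
    unfolding cardC using finA by (metis (no_types, lifting) \<B>_def card_Un_disjoint disjoint_iff finite_Un mem_Collect_eq)
  define P where "P \<F> i = real (card ((\<lambda>x. x \<inter> F i) ` \<F>))" for \<F> i
  have IH: "(real (card \<B>))\<^sup>2 \<le> prod (P \<B>) I" "(real (card \<C>))\<^sup>2 \<le> prod (P \<C>) I"
    using insert.IH[OF sub(1)] insert.IH[OF sub(2)] insert.prems(2) unfolding P_def by auto
  have PB: "P \<B> i \<le> P \<A> i" for i
    unfolding P_def using finA by (intro of_nat_mono card_mono image_mono) (auto simp: \<B>_def)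
  have PC: "P \<C> i \<le> P \<A> i" for i
  proof -
    have "(\<lambda>x. x \<inter> F i) ` \<C> = (\<lambda>x. x - {e}) ` (\<lambda>x. x \<inter> F i) ` {x \<in> \<A>. e \<in> x}"
      by (auto simp: \<C>_def image_image)
    hence "card ((\<lambda>x. x \<inter> F i) ` \<C>) \<le> card ((\<lambda>x. x \<inter> F i) ` {x \<in> \<A>. e \<in> x})"
      using finA by (simp add: card_image_le)
    also have "\<dots> \<le> card ((\<lambda>x. x \<inter> F i) ` \<A>)"
      using finA by (intro card_mono image_mono) auto
    finally show ?thesis by (simp add: P_def)
  qed
  \<comment> \<open>Restoring \<open>e\<close> to the traces of \<open>\<C>\<close> makes them
    traces of \<open>\<A>\<close> containing \<open>e\<close>, hence distinct from those of
    \<open>\<B>\<close>.\<close>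
  have PBC: "P \<B> i + P \<C> i \<le> P \<A> i" if "e \<in> F i" for i
  proof -
    have "card ((\<lambda>x. x \<inter> F i) ` \<C>) = card (Set.insert e ` (\<lambda>x. x \<inter> F i) ` \<C>)"
      by (intro card_image[symmetric] inj_onI) (auto simp: \<C>_def)
    moreover have "card ((\<lambda>x. x \<inter> F i) ` \<B>) + card (Set.insert e ` (\<lambda>x. x \<inter> F i) ` \<C>) =
        card ((\<lambda>x. x \<inter> F i) ` \<B> \<union> Set.insert e ` (\<lambda>x. x \<inter> F i) ` \<C>)"
      using finA by (intro card_Un_disjoint[symmetric]) (auto simp: \<B>_def \<C>_def)
    moreover have "\<dots> \<le> card ((\<lambda>x. x \<inter> F i) ` \<A>)"
      using finA that by (intro card_mono) (auto simp: \<B>_def \<C>_def)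
    ultimately show ?thesis by (simp add: P_def flip: of_nat_add)
  qed
  obtain j l where jl: "j \<in> I" "l \<in> I" "j \<noteq> l" "e \<in> F j" "e \<in> F l" using insert.prems(2) by blast
  define R where "R = prod (P \<A>) (I - {j} - {l})"
  have split: "prod g I = g j * g l * prod g (I - {j} - {l})" for g :: "_ \<Rightarrow> real"
    using jl assms(2) by (simp add: prod.remove[of I j] prod.remove[of "I - {j}" l])
  have nonneg: "P \<F> i \<ge> 0" for \<F> i by (simp add: P_def)
  have R: "prod (P \<B>) I \<le> P \<B> j * P \<B> l * R" "prod (P \<C>) I \<le> P \<C> j * P \<C> l * R"
    unfolding split R_def using nonneg PB PC by (intro mult_left_mono prod_mono; simp)+
  have "(real (card \<A>))\<^sup>2 = (real (card \<B>) + real (card \<C>))\<^sup>2" by (simp add: cardA)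
  also have "\<dots> \<le> (P \<B> j + P \<C> j) * (P \<B> l + P \<C> l) * R"
    using IH R nonneg by (intro shearer_two_fibres) (auto simp: R_def intro: prod_nonneg)
  also have "\<dots> \<le> P \<A> j * P \<A> l * R"
    using nonneg PBC jl by (intro mult_mono) (auto simp: R_def intro: prod_nonneg)
  also have "\<dots> = prod (P \<A>) I" by (simp add: split R_def)
  finally show ?case by (simp add: P_def)
qed

section \<open>Tournaments, stars and sinks\<close>

text \<open>
  A tournament on \<open>0, \<dots>, m - 1\<close> is the set of those pairs \<open>i < j\<close> whose edge points to \<open>i\<close>.
\<close>

definition edges :: "nat \<Rightarrow> (nat \<times> nat) set" where
  "edges m = {(i, j). i < j \<and> j < m}"

definition star :: "nat \<Rightarrow> nat \<Rightarrow> (nat \<times> nat) set" where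
  "star m i = {e \<in> edges m. fst e = i \<or> snd e = i}"

text \<open>At a sink \<open>i\<close> every edge points to \<open>i\<close>: edges with smaller
  endpoint \<open>i\<close> belong to \<open>z\<close>, those with larger endpoint \<open>i\<close>
  do not.\<close>

definition has_sink :: "nat \<Rightarrow> (nat \<times> nat) set \<Rightarrow> bool" where
  "has_sink m z \<longleftrightarrow> (\<exists>i<m. z \<inter> star m i = {e \<in> star m i. fst e = i})"

lemma finite_edges [simp]: "finite (edges m)"
  by (rule finite_subset[of _ "{..<m} \<times> {..<m}"]) (auto simp: edges_def)

lemma finite_star [simp]: "finite (star m i)"
  unfolding star_def by simp

lemma star_subset: "star m i \<subseteq> edges m"
  by (auto simp: star_def)

lemma card_edges: "2 * card (edges m) = m * (m - 1)"
proof (induction m)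
  case (Suc m)
  have "edges (Suc m) = edges m \<union> (\<lambda>i. (i, m)) ` {..<m}" by (auto simp: edges_def less_Suc_eq)
  moreover have "edges m \<inter> (\<lambda>i. (i, m)) ` {..<m} = {}" by (auto simp: edges_def)
  ultimately have "card (edges (Suc m)) = card (edges m) + m"
    by (simp add: card_Un_disjoint card_image inj_on_def)
  with Suc show ?case by (cases m) (auto simp: algebra_simps)
qed (simp add: edges_def)

lemma card_star:
  assumes "i < m"
  shows "card (star m i) = m - 1"
proof -
  have "bij_betw (\<lambda>j. (min i j, max i j)) ({..<m} - {i}) (star m i)"
    by (rule bij_betw_byWitness[where f' = "\<lambda>(a, b). if a = i then b else a"])
       (use assms in \<open>auto simp: star_def edges_def min_def max_def split: if_splits\<close>)
  hence "card (star m i) = card ({..<m} - {i})" by (simp add: bij_betw_same_card)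
  thus ?thesis using assms by simp
qed

text \<open>
  If \<open>\<A> \<times> \<B>\<close> avoids sinks, then for each vertex the trace of \<open>\<A>\<close> on its star and the translate
  of the trace of \<open>\<B>\<close> are disjoint, so the product of their sizes is at most \<open>4 ^ (m - 2)\<close>.
\<close>

lemma sink_free_rectangle_small:
  assumes "\<A> \<subseteq> Pow (edges m)" "\<B> \<subseteq> Pow (edges m)"
    and no: "\<And>x y. x \<in> \<A> \<Longrightarrow> y \<in> \<B> \<Longrightarrow> \<not> has_sink m (sym_diff x y)"
    and K: "2 ^ card (edges m) \<le> K * real (card \<A>)" "2 ^ card (edges m) \<le> K * real (card \<B>)" "K \<ge> 0"
  shows "2 ^ m \<le> K\<^sup>2"
proof -
  define P where "P \<F> i = real (card ((\<lambda>x. x \<inter> star m i) ` \<F>))" for \<F> :: "(nat \<times> nat) set set" and i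
  \<comment> \<open>Each edge lies in the stars of its two endpoints, so the stars form a double
    cover.\<close>
  have cover: "\<exists>j\<in>{..<m}. \<exists>l\<in>{..<m}. j \<noteq> l \<and> e \<in> star m j \<and> e \<in> star m l" if "e \<in> edges m" for e
    using that by (intro bexI[of _ "fst e"] bexI[of _ "snd e"]) (auto simp: edges_def star_def)
  have shearer: "(real (card \<F>))\<^sup>2 \<le> prod (P \<F>) {..<m}" if "\<F> \<subseteq> Pow (edges m)" for \<F>
    unfolding P_def using that cover by (intro shearer_double_cover[of "edges m"]) auto
  \<comment> \<open>The factor 4 on the left avoids the exponent \<open>m - 2\<close>, which would
    be truncated at \<open>m = 1\<close>.\<close>
  have trace: "4 * (P \<A> i * P \<B> i) \<le> 4 ^ (m - 1)" if i: "i < m" for i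
  proof -
    define out where "out = {e \<in> star m i. fst e = i}"
    define U where "U = (\<lambda>x. x \<inter> star m i) ` \<A>"
    define V where "V = (\<lambda>y. y \<inter> star m i) ` \<B>"
    have out: "out \<subseteq> star m i" by (auto simp: out_def)
    have disj: "U \<inter> sym_diff out ` V = {}"
    proof (rule ccontr)
      assume "U \<inter> sym_diff out ` V \<noteq> {}"
      then obtain x y where xy: "x \<in> \<A>" "y \<in> \<B>" "x \<inter> star m i = sym_diff out (y \<inter> star m i)"
        unfolding U_def V_def by auto
      have "sym_diff x y \<inter> star m i = sym_diff (x \<inter> star m i) (y \<inter> star m i)" by blast
      also have "\<dots> = out" unfolding xy(3) using out by blast
      finally have "has_sink m (sym_diff x y)" unfolding has_sink_def out_def using i by blast
      with no xy show False by blast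
    qed
    have sub: "U \<union> sym_diff out ` V \<subseteq> Pow (star m i)" using out by (auto simp: U_def V_def)
    have "finite (U \<union> sym_diff out ` V)" using sub by (rule finite_subset) simp
    have "card V = card (sym_diff out ` V)" by (intro card_image[symmetric] inj_onI) blast
    hence "card U + card V = card (U \<union> sym_diff out ` V)"
      using disj \<open>finite (U \<union> sym_diff out ` V)\<close> by (simp add: card_Un_disjoint)
    also have "\<dots> \<le> card (Pow (star m i))" using sub by (intro card_mono) simp
    finally have "card U + card V \<le> card (Pow (star m i))" .
    hence le: "P \<A> i + P \<B> i \<le> 2 ^ (m - 1)"
      using card_star[OF i] by (simp add: card_Pow P_def U_def V_def flip: of_nat_add)
    have "0 \<le> (P \<A> i - P \<B> i)\<^sup>2" by simp
    hence "4 * (P \<A> i * P \<B> i) \<le> (P \<A> i + P \<B> i)\<^sup>2" by (simp add: power2_eq_square algebra_simps)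
    also have "\<dots> \<le> (2 ^ (m - 1))\<^sup>2" using le by (intro power_mono) (auto simp: P_def)
    also have "\<dots> = 4 ^ (m - 1)" by (simp add: power2_eq_square flip: power_mult_distrib)
    finally show ?thesis .
  qed
  define a where "a = real (card \<A>)"
  define b where "b = real (card \<B>)"
  \<comment> \<open>Both Shearer bounds are multiplied over the vertices; the result is compared
    with \<open>4 ^ (m * (m - 1))\<close>, the fourth power of the number of tournaments.\<close>
  have "4 ^ m * (a\<^sup>2 * b\<^sup>2) \<le> 4 ^ m * (prod (P \<A>) {..<m} * prod (P \<B>) {..<m})"
    unfolding a_def b_def using shearer[OF assms(1)] shearer[OF assms(2)]
    by (intro mult_left_mono mult_mono) (auto intro: prod_nonneg simp: P_def)
  also have "\<dots> = (\<Prod>i<m. 4 * (P \<A> i * P \<B> i))" by (simp add: prod.distrib)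
  also have "\<dots> \<le> (\<Prod>i<m. 4 ^ (m - 1))" using trace by (intro prod_mono) (auto simp: P_def)
  also have "\<dots> = 4 ^ (2 * card (edges m))" unfolding card_edges by (simp add: mult.commute flip: power_mult)
  also have "\<dots> = (2 ^ card (edges m))\<^sup>2 * (2 ^ card (edges m))\<^sup>2"
    by (simp add: power_mult power2_eq_square flip: power_mult_distrib)
  also have "\<dots> \<le> (K * a)\<^sup>2 * (K * b)\<^sup>2"
    unfolding a_def b_def using K by (intro mult_mono power_mono) auto
  finally have "4 ^ m * (a\<^sup>2 * b\<^sup>2) \<le> (K\<^sup>2)\<^sup>2 * (a\<^sup>2 * b\<^sup>2)" by (simp add: power_mult_distrib mult_ac power2_eq_square)
  moreover have "K * a > 0" "K * b > 0"
    unfolding a_def b_def by (rule less_le_trans[OF zero_less_power K(1)], simp)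
      (rule less_le_trans[OF zero_less_power K(2)], simp)
  hence "a > 0" "b > 0" using K(3) by (auto simp: zero_less_mult_iff)
  ultimately have "4 ^ m \<le> (K\<^sup>2)\<^sup>2" by simp
  moreover have "(4 :: real) ^ m = (2 ^ m)\<^sup>2" by (simp add: power2_eq_square flip: power_mult_distrib)
  ultimately have "((2 :: real) ^ m)\<^sup>2 \<le> (K\<^sup>2)\<^sup>2" by (simp only:)
  thus ?thesis by (rule power2_le_imp_le) simp
qed

text \<open>A single row suffices: translation by \<open>x\<close> maps \<open>\<B>\<close>
  injectively to tournaments with a sink, and by the union bound these have density at most
  \<open>m / 2 ^ (m - 1)\<close>.\<close>

lemma sink_rectangle_small:
  assumes "x \<in> Pow (edges m)" "\<B> \<subseteq> Pow (edges m)"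
    and sink: "\<And>y. y \<in> \<B> \<Longrightarrow> has_sink m (sym_diff x y)"
    and K: "2 ^ card (edges m) \<le> K * real (card \<B>)" "K \<ge> 0"
  shows "2 ^ m \<le> 2 * real m * K"
proof -
  define S where "S i = {z \<in> Pow (edges m). z \<inter> star m i = {e \<in> star m i. fst e = i}}" for i
  have cardS: "2 ^ m * card (S i) \<le> 2 * 2 ^ card (edges m)" if i: "i < m" for i
  proof -
    have "inj_on (\<lambda>z. z - star m i) (S i)"
    proof (rule inj_onI)
      fix x y assume "x \<in> S i" "y \<in> S i" "x - star m i = y - star m i"
      moreover from this have "x \<inter> star m i = y \<inter> star m i" by (simp add: S_def)
      ultimately show "x = y" by blast
    qed
    moreover have "(\<lambda>z. z - star m i) ` S i \<subseteq> Pow (edges m - star m i)" by (auto simp: S_def)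
    ultimately have "card (S i) \<le> card (Pow (edges m - star m i))"
      by (metis card_image card_mono finite_Diff finite_Pow_iff finite_edges)
    also have "\<dots> = 2 ^ (card (edges m) - (m - 1))"
      using card_star[OF i] star_subset[of m i] by (simp add: card_Pow card_Diff_subset)
    finally have "2 ^ m * card (S i) \<le> 2 ^ m * 2 ^ (card (edges m) - (m - 1))" by simp
    also have "\<dots> = 2 ^ (m + (card (edges m) - (m - 1)))" by (simp add: power_add)
    also have "m + (card (edges m) - (m - 1)) = Suc (card (edges m))"
      using i card_mono[OF finite_edges star_subset, of m i] card_star[OF i] by simp
    finally show ?thesis by simp
  qed
  have "inj_on (sym_diff x) \<B>" by (rule inj_onI) blast
  hence "card \<B> = card (sym_diff x ` \<B>)" by (simp add: card_image)
  also have "\<dots> \<le> card (\<Union>i<m. S i)"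
  proof (rule card_mono)
    show "sym_diff x ` \<B> \<subseteq> (\<Union>i<m. S i)"
    proof
      fix z assume "z \<in> sym_diff x ` \<B>"
      then obtain y where y: "y \<in> \<B>" "z = sym_diff x y" by blast
      then obtain i where "i < m" "z \<inter> star m i = {e \<in> star m i. fst e = i}"
        using sink unfolding has_sink_def by auto
      moreover have "z \<in> Pow (edges m)" using y assms(1,2) by blast
      ultimately show "z \<in> (\<Union>i<m. S i)" unfolding S_def by blast
    qed
    show "finite (\<Union>i<m. S i)" unfolding S_def by simp
  qed
  also have "\<dots> \<le> (\<Sum>i<m. card (S i))" by (rule card_UN_le) simp
  finally have "2 ^ m * card \<B> \<le> (\<Sum>i<m. 2 ^ m * card (S i))"
    unfolding sum_distrib_left [symmetric] by (rule mult_left_mono) simp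
  also have "\<dots> \<le> (\<Sum>i<m. 2 * 2 ^ card (edges m))" by (intro sum_mono cardS) auto
  finally have "2 ^ m * card \<B> \<le> 2 * m * 2 ^ card (edges m)" by simp
  hence "real (2 ^ m * card \<B>) \<le> real (2 * m * 2 ^ card (edges m))" by (rule of_nat_mono)
  hence "2 ^ m * real (card \<B>) \<le> 2 * real m * 2 ^ card (edges m)" by simp
  also have "\<dots> \<le> 2 * real m * (K * real (card \<B>))" using K by (intro mult_left_mono) auto
  finally have "2 ^ m * real (card \<B>) \<le> 2 * real m * K * real (card \<B>)" by (simp add: mult_ac)
  moreover have "K * real (card \<B>) > 0" by (rule less_le_trans[OF zero_less_power K(1)]) simp
  hence "real (card \<B>) > 0" using K(2) by (auto simp: zero_less_mult_iff)
  ultimately show ?thesis by simp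
qed

subsection \<open>Tournaments without a sink\<close>

text \<open>
  The variables \<open>var m i j\<close> and \<open>var m j i\<close> jointly encode the orientation of the edge between \<open>i\<close>
  and \<open>j\<close>, as their parity. The diagonal variables belong to no edge; the first of them, \<open>var m 0 0 = 1\<close>,
  guards the sink test below and thereby keeps the mean of the function at least \<open>1 / 2\<close>.
\<close>

definition var :: "nat \<Rightarrow> nat \<Rightarrow> nat \<Rightarrow> nat" where
  "var m i j = m * i + j + 1"

text \<open>At \<open>(0, 0)\<close> the two variables coincide, so the guard can be treated as one
  more edge.\<close>

definition edge_vars :: "nat \<Rightarrow> nat \<times> nat \<Rightarrow> nat set" where
  "edge_vars m e = {var m (fst e) (snd e), var m (snd e) (fst e)}"

definition guarded_sink :: "nat \<Rightarrow> (nat \<Rightarrow> nat) \<Rightarrow> nat \<Rightarrow> bool" where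
  "guarded_sink m x i \<longleftrightarrow>
     (\<forall>e\<in>insert (0, 0) (star m i). (parity_of (edge_vars m e) x = 1) = (fst e = i \<or> e = (0, 0)))"

definition no_sink :: bool_family where
  "no_sink = (\<lambda>k. k\<^sup>2, \<lambda>k x. if \<exists>i<k. guarded_sink k x i then 0 else 1)"

lemma var_inject:
  assumes "j < m" "j' < m"
  shows "var m i j = var m i' j' \<longleftrightarrow> i = i' \<and> j = j'"
proof
  assume "var m i j = var m i' j'"
  hence eq: "m * i + j = m * i' + j'" by (simp add: var_def)
  have "(m * i + j) div m = i" "(m * i' + j') div m = i'" using assms by simp_all
  with eq show "i = i' \<and> j = j'" by auto
qed simp

lemma var_mem:
  assumes "i < m" "j < m"
  shows "var m i j \<in> {1..m\<^sup>2}"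
proof -
  have "m * i + j + 1 \<le> m * (i + 1)" using assms by simp
  also have "\<dots> \<le> m * m" using assms by (intro mult_left_mono) auto
  finally show ?thesis by (simp add: var_def power2_eq_square)
qed

lemma star_bounds: "e \<in> star m i \<Longrightarrow> fst e < snd e \<and> snd e < m"
  by (auto simp: star_def edges_def)

lemma edge_vars_subset:
  assumes "e \<in> insert (0, 0) (star m i)" "i < m"
  shows "edge_vars m e \<subseteq> {1..m\<^sup>2}"
proof -
  have "fst e < m" "snd e < m" using assms star_bounds[of e m i] by auto
  thus ?thesis using var_mem by (simp add: edge_vars_def)
qed

text \<open>The edge between two vertices points to only one of them.\<close>

lemma guarded_sink_unique:
  assumes "guarded_sink m x i" "guarded_sink m x j" "i < m" "j < m"
  shows "i = j"
proof (rule ccontr)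
  assume "i \<noteq> j"
  define e where "e = (min i j, max i j)"
  have "e \<in> star m i" "e \<in> star m j" "e \<noteq> (0, 0)" and fst: "fst e = i \<longleftrightarrow> \<not> fst e = j"
    using assms \<open>i \<noteq> j\<close> by (auto simp: e_def star_def edges_def min_def max_def)
  thus False using assms(1,2) fst unfolding guarded_sink_def by blast
qed

text \<open>The value of the character of \<open>e\<close> demanded at a guarded sink
  \<open>i\<close>: negative where the parity must be 1.\<close>

definition edge_sign :: "nat \<Rightarrow> nat \<times> nat \<Rightarrow> real" where
  "edge_sign i e = (if fst e = i \<or> e = (0, 0) then - 1 else 1)"

lemma guarded_sink_indicator:
  "(\<Prod>e\<in>insert (0, 0) (star m i). (1 + edge_sign i e * character (edge_vars m e) x) / 2) =
    (if guarded_sink m x i then 1 else 0)"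
proof -
  have "(1 + edge_sign i e * character (edge_vars m e) x) / 2 =
      (if (parity_of (edge_vars m e) x = 1) = (fst e = i \<or> e = (0, 0)) then 1 else 0)" for e
  proof -
    have "parity_of (edge_vars m e) x = 0 \<or> parity_of (edge_vars m e) x = 1"
      unfolding parity_of_def by linarith
    thus ?thesis by (auto simp: edge_sign_def character_parity)
  qed
  thus ?thesis
    unfolding guarded_sink_def by (auto intro!: prod.neutral prod_zero)
qed

text \<open>By uniqueness of sinks, the indicators add up to the indicator of their
  disjunction.\<close>

lemma no_sink_expansion:
  "real (snd no_sink m x) = 1 + (\<Sum>i<m. - 1 * (\<Prod>e\<in>insert (0, 0) (star m i).
    (1 + edge_sign i e * character (edge_vars m e) x) / 2))"
proof -
  have "(\<Sum>i<m. - 1 * (if guarded_sink m x i then 1 else 0 :: real)) =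
      - (if \<exists>i<m. guarded_sink m x i then 1 else 0)"
  proof (cases "\<exists>i<m. guarded_sink m x i")
    case True
    then obtain i where i: "i < m" "guarded_sink m x i" by blast
    have "(\<Sum>j<m. - 1 * (if guarded_sink m x j then 1 else 0 :: real)) =
        (\<Sum>j<m. if j = i then - 1 else 0)"
      using i guarded_sink_unique[of m x] by (intro sum.cong) auto
    thus ?thesis using True i by simp
  qed auto
  thus ?thesis unfolding guarded_sink_indicator by (simp add: no_sink_def)
qed

lemma no_sink_in_bool_families: "no_sink \<in> bool_families"
  by (auto simp: no_sink_def bool_families_def strict_mono_on_def power_strict_mono)

lemma no_sink_in_PL_1: "no_sink \<in> PL_1"
proof -
  have "spectral_norm (m\<^sup>2) (\<lambda>x. real (snd no_sink m x)) \<le> poly [:1, 1:] (real (m\<^sup>2))" for m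
  proof -
    let ?P = "\<lambda>i x. \<Prod>e\<in>insert (0, 0) (star m i). (1 + edge_sign i e * character (edge_vars m e) x) / 2"
    have "spectral_norm (m\<^sup>2) (\<lambda>x. real (snd no_sink m x)) \<le>
        spectral_norm (m\<^sup>2) (\<lambda>x. 1) + spectral_norm (m\<^sup>2) (\<lambda>x. \<Sum>i<m. - 1 * ?P i x)"
      unfolding no_sink_expansion by (rule spectral_norm_add)
    also have "\<dots> \<le> 1 + (\<Sum>i<m. spectral_norm (m\<^sup>2) (\<lambda>x. - 1 * ?P i x))"
      unfolding spectral_norm_one by (intro add_left_mono spectral_norm_sum)
    also have "\<dots> \<le> 1 + (\<Sum>i<m. 1)"
    proof (intro add_left_mono sum_mono)
      fix i assume "i \<in> {..<m}"
      hence "spectral_norm (m\<^sup>2) (?P i) \<le> 1"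
        using edge_vars_subset by (intro spectral_norm_prod_half) (auto simp: edge_sign_def)
      thus "spectral_norm (m\<^sup>2) (\<lambda>x. - 1 * ?P i x) \<le> 1" unfolding spectral_norm_cmult by simp
    qed
    also have "real m \<le> real (m\<^sup>2)" by (simp only: of_nat_le_iff power2_nat_le_imp_le[OF order_refl])
    hence "1 + (\<Sum>i<m. 1) \<le> poly [:1, 1:] (real (m\<^sup>2))" by simp
    finally show ?thesis .
  qed
  thus ?thesis
    using no_sink_in_bool_families unfolding PL_1_def no_sink_def spectral_norm_def by (auto intro: exI[of _ "[:1, 1:]"])
qed

text \<open>The coefficient at the empty set is the mean. Half of the points have guard variable 0,
  and there the value is 1.\<close>

lemma no_sink_in_PL_inf: "no_sink \<in> PL_inf"
proof -
  have "1 / 2 \<le> Max ((\<lambda>S. \<bar>fourier_coeff (m\<^sup>2) (\<lambda>x. real (snd no_sink m x)) S\<bar>) ` Pow {1..m\<^sup>2})"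
    if "m \<ge> 1" for m
  proof -
    have var0: "var m 0 0 = 1" by (simp add: var_def)
    have guard: "{1} \<subseteq> {1..m\<^sup>2}" using var_mem[of 0 m 0] that var0 by simp
    have "(1 + character {1} x) / 2 \<le> real (snd no_sink m x)" for x
      using var0 by (auto simp: no_sink_def guarded_sink_def edge_vars_def character_parity)
    hence "(\<Sum>x\<in>bool_cube (m\<^sup>2). (1 + character {1} x) / 2) \<le> (\<Sum>x\<in>bool_cube (m\<^sup>2). real (snd no_sink m x))"
      by (intro sum_mono)
    moreover have "(\<Sum>x\<in>bool_cube (m\<^sup>2). (1 + character {1} x) / 2) = 2 ^ m\<^sup>2 / 2"
      unfolding sum_divide_distrib [symmetric] sum.distrib sum_character[OF guard]
      by (simp add: card_bool_cube)
    ultimately have "1 / 2 \<le> fourier_coeff (m\<^sup>2) (\<lambda>x. real (snd no_sink m x)) {}"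
      by (simp add: fourier_coeff_def field_simps)
    also have "\<dots> \<le> \<bar>fourier_coeff (m\<^sup>2) (\<lambda>x. real (snd no_sink m x)) {}\<bar>" by (rule abs_ge_self)
    also have "\<dots> \<le> Max ((\<lambda>S. \<bar>fourier_coeff (m\<^sup>2) (\<lambda>x. real (snd no_sink m x)) S\<bar>) ` Pow {1..m\<^sup>2})"
      by (rule Max_ge) auto
    finally show ?thesis .
  qed
  thus ?thesis
    using no_sink_in_bool_families unfolding PL_inf_def no_sink_def by (auto intro!: exI[of _ "[:2:]"])
qed

section \<open>Restriction to a two-player matrix and the size bound\<close>

definition cube_point :: "nat \<Rightarrow> nat set \<Rightarrow> nat \<Rightarrow> nat" where
  "cube_point n Z = (\<lambda>t\<in>{1..n}. if t \<in> Z then 1 else 0)"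

definition row_vars :: "nat \<Rightarrow> (nat \<times> nat) set \<Rightarrow> nat set" where
  "row_vars m x = (\<lambda>e. var m (fst e) (snd e)) ` x"

definition col_vars :: "nat \<Rightarrow> (nat \<times> nat) set \<Rightarrow> nat set" where
  "col_vars m y = (\<lambda>e. var m (snd e) (fst e)) ` y"

text \<open>The row player sets the variables above the diagonal, the column player those below. The
  guard is fixed to 1 and the rest of the diagonal to 0.\<close>

definition matrix_point :: "nat \<Rightarrow> (nat \<times> nat) set \<Rightarrow> (nat \<times> nat) set \<Rightarrow> nat \<Rightarrow> nat" where
  "matrix_point m x y = cube_point (m\<^sup>2) (insert (var m 0 0) (row_vars m x \<union> col_vars m y))"

lemma cube_point_mem: "cube_point n Z \<in> bool_cube n"
  by (auto simp: cube_point_def bool_cube_def)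

lemma ltf_cube_point:
  assumes "Z \<subseteq> {1..n}"
  shows "ltf n w (cube_point n Z) = threshold_sign (w 0 + (\<Sum>t\<in>Z. w t))"
proof -
  have "(\<Sum>t=1..n. w t * real (cube_point n Z t)) = (\<Sum>t\<in>{1..n}. if t \<in> Z then w t else 0)"
    by (intro sum.cong) (auto simp: cube_point_def)
  also have "\<dots> = (\<Sum>t\<in>Z. w t)"
    using assms by (simp add: sum.If_cases Int_absorb1)
  finally show ?thesis by (simp add: ltf_def)
qed

lemma edges_bounds: "x \<subseteq> edges m \<Longrightarrow> e \<in> x \<Longrightarrow> fst e < snd e \<and> snd e < m"
  by (auto simp: edges_def)

lemma matrix_vars_subset:
  assumes "x \<subseteq> edges m" "y \<subseteq> edges m" "m \<ge> 1"
  shows "insert (var m 0 0) (row_vars m x \<union> col_vars m y) \<subseteq> {1..m\<^sup>2}"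
proof -
  have "row_vars m x \<subseteq> {1..m\<^sup>2}" "col_vars m y \<subseteq> {1..m\<^sup>2}"
    using edges_bounds[OF assms(1)] edges_bounds[OF assms(2)]
    unfolding row_vars_def col_vars_def by (intro image_subsetI var_mem; force)+
  thus ?thesis using var_mem[of 0 m 0] assms(3) by simp
qed

lemma matrix_vars_disjoint:
  assumes "x \<subseteq> edges m" "y \<subseteq> edges m" "m \<ge> 1"
  shows "var m 0 0 \<notin> row_vars m x \<union> col_vars m y" "row_vars m x \<inter> col_vars m y = {}"
proof -
  note x = edges_bounds[OF assms(1)] and y = edges_bounds[OF assms(2)]
  show "var m 0 0 \<notin> row_vars m x \<union> col_vars m y"
    using x y assms(3) by (force simp: row_vars_def col_vars_def var_inject)
  show "row_vars m x \<inter> col_vars m y = {}"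
  proof (rule ccontr)
    assume "row_vars m x \<inter> col_vars m y \<noteq> {}"
    then obtain e e' where e: "e \<in> x" "e' \<in> y" "var m (fst e) (snd e) = var m (snd e') (fst e')"
      by (auto simp: row_vars_def col_vars_def)
    with x[of e] y[of e'] show False by (simp add: var_inject)
  qed
qed

text \<open>The linear form splits into a row part and a column part, as the rectangle argument
  requires; constant and guard weight are put with the row.\<close>

lemma ltf_matrix_point:
  assumes "x \<subseteq> edges m" "y \<subseteq> edges m" "m \<ge> 1"
  shows "ltf (m\<^sup>2) w (matrix_point m x y) =
    threshold_sign ((w 0 + w (var m 0 0) + (\<Sum>e\<in>x. w (var m (fst e) (snd e)))) + (\<Sum>e\<in>y. w (var m (snd e) (fst e))))"
proof -
  note x = edges_bounds[OF assms(1)] and y = edges_bounds[OF assms(2)]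
  have fin: "finite x" "finite y" using assms finite_subset finite_edges by blast+
  have inj: "inj_on (\<lambda>e. var m (fst e) (snd e)) x"
  proof (rule inj_onI)
    fix e e' assume "e \<in> x" "e' \<in> x" "var m (fst e) (snd e) = var m (fst e') (snd e')"
    with x[of e] x[of e'] show "e = e'" by (simp add: var_inject prod_eq_iff)
  qed
  have inj': "inj_on (\<lambda>e. var m (snd e) (fst e)) y"
  proof (rule inj_onI)
    fix e e' assume "e \<in> y" "e' \<in> y" "var m (snd e) (fst e) = var m (snd e') (fst e')"
    with y[of e] y[of e'] show "e = e'" by (simp add: var_inject prod_eq_iff)
  qed
  have "(\<Sum>t\<in>insert (var m 0 0) (row_vars m x \<union> col_vars m y). w t) =
      w (var m 0 0) + ((\<Sum>t\<in>row_vars m x. w t) + (\<Sum>t\<in>col_vars m y. w t))"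
    using matrix_vars_disjoint[OF assms] fin
    by (subst sum.insert) (simp_all add: sum.union_disjoint row_vars_def col_vars_def)
  moreover have "(\<Sum>t\<in>row_vars m x. w t) = (\<Sum>e\<in>x. w (var m (fst e) (snd e)))"
    unfolding row_vars_def by (simp add: sum.reindex[OF inj])
  moreover have "(\<Sum>t\<in>col_vars m y. w t) = (\<Sum>e\<in>y. w (var m (snd e) (fst e)))"
    unfolding col_vars_def by (simp add: sum.reindex[OF inj'])
  ultimately show ?thesis
    unfolding matrix_point_def ltf_cube_point[OF matrix_vars_subset[OF assms]]
    by (simp add: add.assoc)
qed

lemma parity_matrix_point:
  assumes "x \<subseteq> edges m" "y \<subseteq> edges m" "e \<in> edges m"
  shows "parity_of (edge_vars m e) (matrix_point m x y) = 1 \<longleftrightarrow> e \<in> sym_diff x y"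
proof -
  note x = edges_bounds[OF assms(1)] and y = edges_bounds[OF assms(2)]
  have e: "fst e < snd e" "snd e < m" using assms(3) by (auto simp: edges_def)
  have row: "var m (fst e) (snd e) \<in> insert (var m 0 0) (row_vars m x \<union> col_vars m y) \<longleftrightarrow> e \<in> x"
  proof
    assume "e \<in> x"
    thus "var m (fst e) (snd e) \<in> insert (var m 0 0) (row_vars m x \<union> col_vars m y)"
      by (auto simp: row_vars_def)
  next
    assume "var m (fst e) (snd e) \<in> insert (var m 0 0) (row_vars m x \<union> col_vars m y)"
    then consider "var m (fst e) (snd e) = var m 0 0"
      | e' where "e' \<in> x" "var m (fst e) (snd e) = var m (fst e') (snd e')"
      | e' where "e' \<in> y" "var m (fst e) (snd e) = var m (snd e') (fst e')"
      by (auto simp: row_vars_def col_vars_def)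
    thus "e \<in> x"
    proof cases
      case 1 with e show ?thesis by (simp add: var_inject)
    next
      case (2 e')
      with e x[of e'] have "e = e'" by (simp add: var_inject prod_eq_iff)
      with 2 show ?thesis by simp
    next
      case (3 e') with e y[of e'] show ?thesis by (simp add: var_inject)
    qed
  qed
  have col: "var m (snd e) (fst e) \<in> insert (var m 0 0) (row_vars m x \<union> col_vars m y) \<longleftrightarrow> e \<in> y"
  proof
    assume "e \<in> y"
    thus "var m (snd e) (fst e) \<in> insert (var m 0 0) (row_vars m x \<union> col_vars m y)"
      by (auto simp: col_vars_def)
  next
    assume "var m (snd e) (fst e) \<in> insert (var m 0 0) (row_vars m x \<union> col_vars m y)"
    then consider "var m (snd e) (fst e) = var m 0 0"
      | e' where "e' \<in> x" "var m (snd e) (fst e) = var m (fst e') (snd e')"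
      | e' where "e' \<in> y" "var m (snd e) (fst e) = var m (snd e') (fst e')"
      by (auto simp: row_vars_def col_vars_def)
    thus "e \<in> y"
    proof cases
      case 1 with e show ?thesis by (simp add: var_inject)
    next
      case (2 e') with e x[of e'] show ?thesis by (simp add: var_inject)
    next
      case (3 e')
      with e y[of e'] have "e = e'" by (simp add: var_inject prod_eq_iff)
      with 3 show ?thesis by simp
    qed
  qed
  have "var m (fst e) (snd e) \<noteq> var m (snd e) (fst e)" using e by (simp add: var_inject)
  hence "parity_of (edge_vars m e) (matrix_point m x y) = ((if e \<in> x then 1 else 0) + (if e \<in> y then 1 else 0)) mod 2"
    using row col e var_mem[of "fst e" m "snd e"] var_mem[of "snd e" m "fst e"]
    by (simp add: parity_of_def edge_vars_def matrix_point_def cube_point_def)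
  thus ?thesis by auto
qed

lemma no_sink_matrix_point:
  assumes "x \<subseteq> edges m" "y \<subseteq> edges m" "m \<ge> 1"
  shows "snd no_sink m (matrix_point m x y) = (if has_sink m (sym_diff x y) then 0 else 1)"
proof -
  have "parity_of (edge_vars m (0, 0)) (matrix_point m x y) = 1"
    using var_mem[of 0 m 0] assms(3) by (simp add: parity_of_def edge_vars_def matrix_point_def cube_point_def)
  hence "guarded_sink m (matrix_point m x y) i \<longleftrightarrow>
      (\<forall>e\<in>star m i. (parity_of (edge_vars m e) (matrix_point m x y) = 1) = (fst e = i \<or> e = (0, 0)))" for i
    unfolding guarded_sink_def by simp
  moreover have "(parity_of (edge_vars m e) (matrix_point m x y) = 1) = (fst e = i \<or> e = (0, 0)) \<longleftrightarrow>
      e \<in> sym_diff x y = (fst e = i)" if "e \<in> star m i" for e i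
    using that star_bounds[OF that] parity_matrix_point[OF assms(1,2), of e] star_subset by auto
  ultimately have "guarded_sink m (matrix_point m x y) i \<longleftrightarrow>
      (\<forall>e\<in>star m i. e \<in> sym_diff x y = (fst e = i))" for i
    by (metis (no_types, lifting))
  moreover have "(\<forall>e\<in>star m i. e \<in> sym_diff x y = (fst e = i)) \<longleftrightarrow>
      sym_diff x y \<inter> star m i = {e \<in> star m i. fst e = i}" for i
    by blast
  ultimately show ?thesis by (simp add: no_sink_def has_sink_def)
qed

text \<open>The monochromatic rectangle has density at least \<open>1 / (2 * s)\<close> on both
  sides, so either rectangle bound applies with \<open>K = 2 * s\<close>.\<close>

lemma no_sink_ldl_size:
  assumes "computes_ldl (m\<^sup>2) s W a (snd no_sink m)" "m \<ge> 2"
  shows "2 ^ m \<le> 4 * (real m)\<^sup>2 * (real s)\<^sup>2"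
proof -
  define E where "E = edges m"
  define u where "u i x = W i 0 + W i (var m 0 0) + (\<Sum>e\<in>x. W i (var m (fst e) (snd e)))" for i x
  define v where "v i y = (\<Sum>e\<in>y. W i (var m (snd e) (fst e)))" for i y
  define c where "c = 2 ^ card E div s"
  have s: "s \<ge> 1" using assms(1) by (simp add: computes_ldl_def)
  have query: "ltf (m\<^sup>2) (W i) (matrix_point m x y) = 1 \<longleftrightarrow> u i x + v i y > 0"
    if "x \<in> Pow E" "y \<in> Pow E" for i x y
    using ltf_matrix_point[of x m y "W i"] that assms(2)
    by (simp add: E_def u_def v_def threshold_sign_def)
  have point: "matrix_point m x y \<in> bool_cube (m\<^sup>2)" for x y
    unfolding matrix_point_def by (rule cube_point_mem)
  have K: "2 ^ m \<le> 4 * (real m)\<^sup>2 * (real s)\<^sup>2" if K: "2 ^ m \<le> (2 * real s)\<^sup>2 \<or> 2 ^ m \<le> 2 * real m * (2 * real s)"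
  proof -
    have ms: "1 \<le> real m * real s" using assms(2) s by (simp add: one_le_mult_iff flip: of_nat_mult)
    have "(2 * real s)\<^sup>2 * 1 \<le> (2 * real s)\<^sup>2 * (real m)\<^sup>2"
      using assms(2) by (intro mult_left_mono) auto
    moreover have "4 * (real m * real s) * 1 \<le> 4 * (real m * real s) * (real m * real s)"
      using ms by (intro mult_left_mono) auto
    ultimately show ?thesis using K by (auto simp: power2_eq_square algebra_simps)
  qed
  show ?thesis
  proof (cases "s \<le> 2 ^ card E")
    case False
    \<comment> \<open>A list longer than the number of rows would give \<open>c = 0\<close>, but it
      meets the bound already because \<open>m \<le> m * (m - 1)\<close>.\<close>
    have "m \<le> 2 * card E" unfolding E_def card_edges using assms(2) by simp
    hence "(2 :: real) ^ m \<le> 2 ^ (2 * card E)" by (intro power_increasing) auto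
    also have "\<dots> = (real (2 ^ card E))\<^sup>2" by (simp add: power_mult power2_eq_square flip: power_mult_distrib)
    also have "\<dots> \<le> (2 * real s)\<^sup>2"
    proof (rule power_mono)
      have "real (2 ^ card E) \<le> real s" using False by (intro of_nat_mono) simp
      thus "real (2 ^ card E) \<le> 2 * real s" by linarith
    qed simp
    finally show ?thesis using K by blast
  next
    case True
    have "c \<ge> 1" using True s by (simp add: c_def div_greater_zero_iff Suc_le_eq)
    \<comment> \<open>Rounding down costs at most a factor 2, as \<open>c \<ge> 1\<close>.\<close>
    have "2 ^ card E = s * c + 2 ^ card E mod s" unfolding c_def by simp
    also have "\<dots> \<le> s * c + s" using s by (intro add_left_mono less_imp_le mod_less_divisor) auto
    also have "\<dots> \<le> 2 * s * c" using \<open>c \<ge> 1\<close> by simp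
    finally have "real (2 ^ card E) \<le> real (2 * s * c)" by (rule of_nat_mono)
    hence c: "2 ^ card E \<le> (2 * real s) * real c" by simp
    have cardE: "s * c \<le> card (Pow E)" by (simp add: card_Pow E_def c_def)
    have fin: "finite (Pow E)" by (simp add: E_def)
    have accept: "\<forall>x\<in>bool_cube (m\<^sup>2). ltf (m\<^sup>2) (W s) x = 1"
      and outcome: "\<forall>x\<in>bool_cube (m\<^sup>2). snd no_sink m x = a (LEAST i. i \<in> {1..s} \<and> ltf (m\<^sup>2) (W i) x = 1)"
      using assms(1) unfolding computes_ldl_def by blast+
    have last: "u s x + v s y > 0" if "x \<in> Pow E" "y \<in> Pow E" for x y
      using accept point query[OF that] by blast
    have eval: "snd no_sink m (matrix_point m x y) = a (LEAST i. i \<in> {1..s} \<and> u i x + v i y > 0)"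
      if "x \<in> Pow E" "y \<in> Pow E" for x y
      using bspec[OF outcome point[of x y]] unfolding query[OF that] .
    obtain \<A> \<B> b where AB: "\<A> \<subseteq> Pow E" "\<B> \<subseteq> Pow E" "card \<A> = c" "card \<B> = c"
      and mono: "\<forall>x\<in>\<A>. \<forall>y\<in>\<B>. snd no_sink m (matrix_point m x y) = b"
      by (rule decision_list_monochromatic_rectangle[where u = u and v = v and a = a
          and f = "\<lambda>x y. snd no_sink m (matrix_point m x y)", OF fin fin s cardE cardE last eval]) blast
    have val: "has_sink m (sym_diff x y) \<longleftrightarrow> b = 0" if "x \<in> \<A>" "y \<in> \<B>" for x y
      proof -
      have "x \<subseteq> edges m" "y \<subseteq> edges m" using that AB by (auto simp: E_def)
      from no_sink_matrix_point[OF this] show ?thesis using mono that assms(2) by (auto split: if_splits)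
    qed
    show ?thesis
    proof (cases "b = 0")
      case True
      have "\<A> \<noteq> {}" using AB \<open>c \<ge> 1\<close> by auto
      then obtain x where x: "x \<in> \<A>" by blast
      have "2 ^ m \<le> 2 * real m * (2 * real s)"
        using AB x val[OF x] True c unfolding E_def
        by (intro sink_rectangle_small[of x m \<B>]) auto
      thus ?thesis using K by blast
    next
      case False
      have "2 ^ m \<le> (2 * real s)\<^sup>2"
        using AB val False c unfolding E_def
        by (intro sink_free_rectangle_small[of \<A> m \<B>]) auto
      thus ?thesis using K by blast
    qed
  qed
qed

lemma no_sink_not_in_LDL: "no_sink \<notin> LDL"
proof
  assume "no_sink \<in> LDL"
  then obtain p where p: "\<And>k. k \<ge> 1 \<Longrightarrow> \<exists>s W a. real s \<le> poly p (real (k\<^sup>2)) \<and>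
      computes_ldl (k\<^sup>2) s W a (snd no_sink k)"
    unfolding LDL_def no_sink_def by auto
  \<comment> \<open>The dimension is \<open>m^2\<close>, so \<open>p\<close> is composed with the
    square before it enters the size bound.\<close>
  define q where "q = 4 * [:0, 1:]\<^sup>2 * (pcompose p ([:0, 1:]\<^sup>2))\<^sup>2"
  obtain m where m: "m \<ge> 2" "poly q (real m) < 2 ^ m" using poly_less_two_power by blast
  obtain s W a where s: "real s \<le> poly p (real (m\<^sup>2))" "computes_ldl (m\<^sup>2) s W a (snd no_sink m)"
    using p[of m] m by auto
  have "2 ^ m \<le> 4 * (real m)\<^sup>2 * (real s)\<^sup>2" using no_sink_ldl_size s m by blast
  also have "\<dots> \<le> 4 * (real m)\<^sup>2 * (poly p (real (m\<^sup>2)))\<^sup>2"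
    using s by (intro mult_left_mono power_mono) auto
  also have "\<dots> = poly q (real m)" by (simp add: q_def poly_pcompose)
  finally show False using m by simp
qed

theorem corollary37:
  shows "(\<forall>A\<in>{LDL_hat, LDL}. \<forall>B\<in>{PL_1, PL_inf}. incomparable A B) \<and>
         (\<forall>B\<in>{PL_1, PT_1_hat, PT_1, PL_inf}. \<forall>A\<in>{LDL_hat, LDL}. incomparable B A)"
proof -
  have "\<not> A \<subseteq> B \<and> \<not> B \<subseteq> A" if "A \<in> {LDL_hat, LDL}" "B \<in> {PL_1, PT_1_hat, PT_1, PL_inf}" for A B
  proof
    have A: "LDL_hat \<subseteq> A" "A \<subseteq> LDL" using that(1) LDL_hat_subset_LDL by auto
    \<comment> \<open>The zero family serves \<open>PL_inf\<close>; the quadratic serves the other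
      three classes, all contained in \<open>PT_1\<close>.\<close>
    have "zero_family \<notin> B \<or> complete_quadratic \<notin> B"
      using that(2) complete_quadratic_not_in_PT_1 zero_family_not_in_PL_inf
        PL_1_subset_PT_1_hat PT_1_hat_subset_PT_1 by blast
    thus "\<not> A \<subseteq> B" using A(1) zero_family_in_LDL_hat complete_quadratic_in_LDL_hat by blast
    have "no_sink \<in> B"
      using that(2) no_sink_in_PL_1 no_sink_in_PL_inf PL_1_subset_PT_1_hat PT_1_hat_subset_PT_1 by blast
    thus "\<not> B \<subseteq> A" using A(2) no_sink_not_in_LDL by blast
  qed
  thus ?thesis unfolding incomparable_def by blast
qed

end
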